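(* Let $L_n$ denote the total external length of Kingman's $n$-coalescent. As $n\to\infty$, \[ \frac12\sqrt{\frac{n}{\log n}}\,\bigl(L_n-2\bigr)\ \xrightarrow{d}\ N(0,1). \]
   Context: Kingman's $n$-coalescent ($n\ge 2$) consists of coalescent times $T_1>T_2>\cdots>T_n=0$ such that $\binom{k}{2}(T_{k-1}-T_k)$, $k=2,\dots,n$, are independent exponential random variables with mean $1$, together with an independent sequence of partitions $\pi_1=\{\{1,\dots,n\}\},\pi_2,\dots,\pi_n=\{\{1\},\dots,\{n\}\}$ of $\{1,\dots,n\}$, where $\pi_k$ has $k$ blocks and $\pi_{k-1}$ is obtained from $\pi_k$ by merging two blocks of $\pi_k$ chosen uniformly at random (independently of the past). For a leaf $i\in\{1,\dots,n\}$ let $\rho(i):=\max\{k\ge1:\{i\}\notin\pi_k\}$; the external branch of leaf $i$ has length $T_{\rho(i)}$. The total external length is $L_n:=\sum_{i=1}^n T_{\rho(i)}$. *)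

theory Defs
  imports "HOL-Probability.Probability"
begin

definition merge_step :: "nat set set \<Rightarrow> nat set set pmf" where
  "merge_step P = map_pmf (\<lambda>D. (P - D) \<union> {\<Union>D}) (pmf_of_set {D. D \<subseteq> P \<and> card D = 2})"

text \<open>kchain m P: the list [pi_after_m_merges, ..., P] of length m+1 (coarsest first).\<close>
fun kchain :: "nat \<Rightarrow> nat set set \<Rightarrow> nat set set list pmf" where
  "kchain 0 P = return_pmf [P]"
| "kchain (Suc m) P = merge_step P \<bind> (\<lambda>Q. map_pmf (\<lambda>xs. xs @ [P]) (kchain m Q))"

text \<open>Partition sequence of Kingman's n-coalescent: list xs with xs ! (k-1) = pi_k.\<close>
definition coal_partitions :: "nat \<Rightarrow> nat set set list pmf" where
  "coal_partitions n = kchain (n - 1) ((\<lambda>i. {i}) ` {1..n})"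

definition rho :: "nat \<Rightarrow> nat set set list \<Rightarrow> nat \<Rightarrow> nat" where
  "rho n xs i = Max {k \<in> {1..n}. {i} \<notin> xs ! (k - 1)}"

text \<open>Coalescent times built from E_j (j = 2..n) iid Exp(1): T_{j-1} - T_j = E_j / binom(j,2), T_n = 0.\<close>
definition coal_time :: "nat \<Rightarrow> (nat \<Rightarrow> real) \<Rightarrow> nat \<Rightarrow> real" where
  "coal_time n e k = (\<Sum>j\<in>{k+1..n}. e j / real (j choose 2))"

definition exp1 :: "real measure" where
  "exp1 = density lborel (exponential_density 1)"

definition kingman :: "nat \<Rightarrow> (nat set set list \<times> (nat \<Rightarrow> real)) measure" where
  "kingman n = measure_pmf (coal_partitions n) \<Otimes>\<^sub>M (\<Pi>\<^sub>M j\<in>{2..n}. exp1)"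

definition ext_length :: "nat \<Rightarrow> nat set set list \<times> (nat \<Rightarrow> real) \<Rightarrow> real" where
  "ext_length n \<omega> = (\<Sum>i\<in>{1..n}. coal_time n (snd \<omega>) (rho n (fst \<omega>) i))"

end

theory Submission
  imports Defs "HOL-Real_Asymp.Real_Asymp"
begin

text \<open>
  Let \<open>V\<^sub>k\<close> be the number of singletons of \<open>\<pi>\<^sub>k\<close>, so that \<open>L\<^sub>n\<close> is the sum of
  \<open>V\<^sub>k (T\<^sub>k\<^sub>-\<^sub>1 - T\<^sub>k)\<close> over \<open>k\<close>. Read from \<open>k = n\<close> downwards, \<open>V\<close> is a Markov chain whose decrement
  \<open>X\<^sub>k = V\<^sub>k - V\<^sub>k\<^sub>-\<^sub>1\<close> is hypergeometric, with conditional mean \<open>2 V\<^sub>k / k\<close>. Replacing the exponential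
  variables by their means costs only \<open>O(n powr (-1/2))\<close>, and what remains of \<open>L\<^sub>n - 2\<close> is the martingale
  sum of \<open>- 2 (X\<^sub>k - 2 V\<^sub>k / k) / (k - 1)\<close>, with conditional variances close to \<open>8 / (k n)\<close>
  since \<open>V\<^sub>k\<close> is close to \<open>k\<^sup>2 / n\<close>. With probability tending to 1 there are no singletons left once \<open>k\<close> is
  slightly below \<open>sqrt n\<close>, so the terms with smaller \<open>k\<close> vanish, although they carry half of the variance
  \<open>8 ln n / n\<close> of \<open>L\<^sub>n\<close>. The terms with larger \<open>k\<close> are uniformly small after normalization and have
  total variance close to \<open>4 ln n / n\<close>. The convergence of the characteristic functions is
  obtained by comparing each conditional characteristic function of an increment with the Gaussian factor.
\<close>

subsection \<open>The chain of partitions\<close>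

text \<open>The law of the number \<open>x\<close> of singleton blocks in a uniformly chosen pair out of \<open>j\<close> blocks,
  \<open>v\<close> of which are singletons.\<close>
definition hyp2 :: "nat \<Rightarrow> nat \<Rightarrow> nat \<Rightarrow> real" where
  "hyp2 j v x = real ((v choose x) * ((j - v) choose (2 - x))) / real (j choose 2)"

definition disjoint_blocks :: "nat set set \<Rightarrow> bool" where
  "disjoint_blocks P \<longleftrightarrow> finite P \<and> disjoint P \<and> {} \<notin> P"

definition num_singletons :: "nat set set \<Rightarrow> nat" where
  "num_singletons P = card {i. {i} \<in> P}"

lemma num_singletons_eq: "num_singletons P = card (P \<inter> range (\<lambda>i. {i}))"
proof -
  have "P \<inter> range (\<lambda>i. {i}) = (\<lambda>i. {i}) ` {i. {i} \<in> P}" by auto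
  then show ?thesis unfolding num_singletons_def by (simp add: card_image inj_on_def)
qed

lemma Union_pair_not_singleton:
  assumes "disjoint_blocks P" "D \<subseteq> P" "card D = 2"
  shows "\<Union>D \<noteq> {i}" "\<Union>D \<notin> P"
proof -
  obtain A B where D: "D = {A, B}" "A \<noteq> B" using assms(3) by (auto simp: card_2_iff)
  have AB: "A \<in> P" "B \<in> P" "A \<noteq> {}" "B \<noteq> {}" using assms D by (auto simp: disjoint_blocks_def)
  have disj: "A \<inter> B = {}" using assms(1) AB D(2) by (auto simp: disjoint_blocks_def disjoint_def)
  obtain a b where ab: "a \<in> A" "b \<in> B" using AB by blast
  then have "a \<noteq> b" "a \<in> \<Union>D" "b \<in> \<Union>D" using disj D by auto
  then show "\<Union>D \<noteq> {i}" by (metis singletonD)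
  show "\<Union>D \<notin> P"
  proof
    assume "\<Union>D \<in> P"
    moreover have "A \<inter> \<Union>D \<noteq> {}" "B \<inter> \<Union>D \<noteq> {}" using ab D by blast+
    moreover have "disjoint P" using assms(1) by (simp add: disjoint_blocks_def)
    ultimately have "A = \<Union>D" "B = \<Union>D" using AB(1,2) disjointD by metis+
    then show False using D(2) by simp
  qed
qed

lemma disjoint_blocks_merge:
  assumes "disjoint_blocks P" "D \<subseteq> P" "card D = 2"
  shows "disjoint_blocks (P - D \<union> {\<Union>D})" "card (P - D \<union> {\<Union>D}) = card P - 1"
    and "{i. {i} \<in> P - D \<union> {\<Union>D}} = {i. {i} \<in> P - D}"
    and "num_singletons (P - D \<union> {\<Union>D}) = num_singletons P - card (D \<inter> (P \<inter> range (\<lambda>i. {i})))"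
proof -
  have fin: "finite P" "finite D" using assms by (auto simp: disjoint_blocks_def finite_subset)
  note U = Union_pair_not_singleton[OF assms]
  have "\<Union>D \<noteq> {}"
  proof -
    obtain B where "B \<in> D" using assms(3) by fastforce
    moreover have "B \<noteq> {}" using \<open>B \<in> D\<close> assms by (auto simp: disjoint_blocks_def)
    ultimately show ?thesis by auto
  qed
  moreover have "disjoint (P - D \<union> {\<Union>D})"
  proof -
    have "disjoint P" using assms(1) by (simp add: disjoint_blocks_def)
    moreover from this have "X \<inter> \<Union>D = {}" if "X \<in> P - D" for X
    proof -
      have "X \<inter> Y = {}" if "Y \<in> D" for Y
        using \<open>disjoint P\<close> that \<open>X \<in> P - D\<close> assms(2)
        by (intro disjointD[of P]) auto
      then show ?thesis by auto
    qed
    ultimately show ?thesis by (auto simp: disjoint_def)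
  qed
  ultimately show "disjoint_blocks (P - D \<union> {\<Union>D})"
    using assms(1) fin by (auto simp: disjoint_blocks_def)
  have le: "2 \<le> card P" using assms fin by (metis card_mono)
  show "card (P - D \<union> {\<Union>D}) = card P - 1"
    using U(2) fin assms le by (simp add: card_insert_if card_Diff_subset)
  show eq: "{i. {i} \<in> P - D \<union> {\<Union>D}} = {i. {i} \<in> P - D}"
    using U(1) by auto
  have "num_singletons (P - D \<union> {\<Union>D}) = card ((P - D) \<inter> range (\<lambda>i. {i}))"
    using eq unfolding num_singletons_eq[symmetric] by (simp add: num_singletons_def)
  also have "(P - D) \<inter> range (\<lambda>i. {i}) = P \<inter> range (\<lambda>i. {i}) - D \<inter> (P \<inter> range (\<lambda>i. {i}))"
    by auto
  also have "card \<dots> = num_singletons P - card (D \<inter> (P \<inter> range (\<lambda>i. {i})))"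
    unfolding num_singletons_eq using fin by (intro card_Diff_subset) auto
  finally show "num_singletons (P - D \<union> {\<Union>D}) = num_singletons P - card (D \<inter> (P \<inter> range (\<lambda>i. {i})))" .
qed

lemma card_subsets_meeting:
  assumes "finite P" "A \<subseteq> P" "x \<le> k"
  shows "card {D. D \<subseteq> P \<and> card D = k \<and> card (D \<inter> A) = x}
           = (card A choose x) * ((card P - card A) choose (k - x))"
proof -
  have finA: "finite A" using assms finite_subset by blast
  let ?X = "{X. X \<subseteq> A \<and> card X = x}" and ?Y = "{Y. Y \<subseteq> P - A \<and> card Y = k - x}"
  have "bij_betw (\<lambda>(X, Y). X \<union> Y) (?X \<times> ?Y) {D. D \<subseteq> P \<and> card D = k \<and> card (D \<inter> A) = x}"
  proof (rule bij_betwI[where g = "\<lambda>D. (D \<inter> A, D - A)"])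
    show "(\<lambda>(X, Y). X \<union> Y) \<in> ?X \<times> ?Y \<rightarrow> {D. D \<subseteq> P \<and> card D = k \<and> card (D \<inter> A) = x}"
    proof clarsimp
      fix X Y assume a: "X \<subseteq> A" "Y \<subseteq> P - A" "card Y = k - card X" "x = card X"
      have "finite X" "finite Y" using a finA assms(1) by (auto intro: finite_subset)
      then have "card (X \<union> Y) = k" using a assms(3) by (subst card_Un_disjoint) auto
      moreover have "(X \<union> Y) \<inter> A = X" using a by auto
      ultimately show "X \<subseteq> P \<and> Y \<subseteq> P \<and> card (X \<union> Y) = k \<and> card ((X \<union> Y) \<inter> A) = card X"
        using a assms by auto
    qed
    show "(\<lambda>D. (D \<inter> A, D - A)) \<in> {D. D \<subseteq> P \<and> card D = k \<and> card (D \<inter> A) = x} \<rightarrow> ?X \<times> ?Y"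
      using finA by (auto simp: card_Diff_subset_Int)
  qed auto
  then have "card {D. D \<subseteq> P \<and> card D = k \<and> card (D \<inter> A) = x} = card (?X \<times> ?Y)"
    by (rule bij_betw_same_card[symmetric])
  also have "\<dots> = (card A choose x) * ((card P - card A) choose (k - x))"
    using assms finA by (simp add: card_cartesian_product n_subsets card_Diff_subset)
  finally show ?thesis .
qed

lemma pairs_finite_nonempty:
  assumes "finite P" "2 \<le> card P"
  shows "finite {D. D \<subseteq> P \<and> card D = 2}" "{D. D \<subseteq> P \<and> card D = 2} \<noteq> {}"
    "card {D. D \<subseteq> P \<and> card D = 2} = card P choose 2"
proof -
  show "finite {D. D \<subseteq> P \<and> card D = 2}" using assms by simp
  show c: "card {D. D \<subseteq> P \<and> card D = 2} = card P choose 2" using assms by (simp add: n_subsets)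
  show "{D. D \<subseteq> P \<and> card D = 2} \<noteq> {}"
  proof
    assume "{D. D \<subseteq> P \<and> card D = 2} = {}"
    then have "card P choose 2 = 0" unfolding c[symmetric] by (simp only: card.empty)
    then show False using assms by (simp add: binomial_eq_0_iff)
  qed
qed

lemma set_merge_step:
  assumes "disjoint_blocks P" "2 \<le> card P"
  shows "set_pmf (merge_step P) = (\<lambda>D. P - D \<union> {\<Union>D}) ` {D. D \<subseteq> P \<and> card D = 2}"
  using pairs_finite_nonempty[of P] assms unfolding merge_step_def disjoint_blocks_def
  by (simp add: set_pmf_of_set)

lemma expectation_merge_step:
  fixes f :: "nat \<Rightarrow> complex"
  assumes "disjoint_blocks P" "2 \<le> card P"
  shows "measure_pmf.expectation (merge_step P) (\<lambda>Q. f (num_singletons Q))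
           = (\<Sum>x\<le>2. hyp2 (card P) (num_singletons P) x * f (num_singletons P - x))"
proof -
  have fin: "finite P" using assms by (simp add: disjoint_blocks_def)
  let ?S = "{D. D \<subseteq> P \<and> card D = 2}" and ?A = "P \<inter> range (\<lambda>i. {i})"
  note S = pairs_finite_nonempty[OF fin assms(2)]
  have "measure_pmf.expectation (merge_step P) (\<lambda>Q. f (num_singletons Q))
      = (\<Sum>D\<in>?S. pmf (pmf_of_set ?S) D *\<^sub>R f (num_singletons (P - D \<union> {\<Union>D})))"
    unfolding merge_step_def using S(1,2)
    by (simp only: integral_map_pmf) (intro integral_measure_pmf, auto simp: set_pmf_of_set)
  also have "\<dots> = (\<Sum>D\<in>?S. f (num_singletons P - card (D \<inter> ?A)) / (card P choose 2))"
  proof (rule sum.cong[OF refl])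
    fix D assume D: "D \<in> ?S"
    have "num_singletons (P - D \<union> {\<Union>D}) = num_singletons P - card (D \<inter> ?A)"
      using D by (intro disjoint_blocks_merge[OF assms(1)]) auto
    moreover have "pmf (pmf_of_set ?S) D = 1 / (card P choose 2)"
      using D S by (simp add: pmf_of_set)
    ultimately show "pmf (pmf_of_set ?S) D *\<^sub>R f (num_singletons (P - D \<union> {\<Union>D}))
        = f (num_singletons P - card (D \<inter> ?A)) / (card P choose 2)"
      by (simp only: scaleR_conv_of_real of_real_divide of_real_1 of_real_of_nat_eq) simp
  qed
  also have "\<dots> = (\<Sum>x\<in>{..2}. \<Sum>D | D \<in> ?S \<and> card (D \<inter> ?A) = x. f (num_singletons P - card (D \<inter> ?A)) / (card P choose 2))"
  proof (rule sum.group[symmetric])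
    show "(\<lambda>D. card (D \<inter> ?A)) ` ?S \<subseteq> {..2}"
    proof clarsimp
      fix D assume "D \<subseteq> P" "card D = 2"
      then show "card (D \<inter> ?A) \<le> 2" using fin by (metis card_mono finite_subset inf_le1)
    qed
  qed (use S in auto)
  also have "\<dots> = (\<Sum>x\<le>2. hyp2 (card P) (num_singletons P) x * f (num_singletons P - x))"
  proof (rule sum.cong[OF refl])
    fix x :: nat assume x: "x \<in> {..2}"
    have "(\<Sum>D | D \<in> ?S \<and> card (D \<inter> ?A) = x. f (num_singletons P - card (D \<inter> ?A)) / (card P choose 2))
        = (\<Sum>D | D \<subseteq> P \<and> card D = 2 \<and> card (D \<inter> ?A) = x. f (num_singletons P - x) / (card P choose 2))"
      by (rule sum.cong) auto
    also have "\<dots> = real (card {D. D \<subseteq> P \<and> card D = 2 \<and> card (D \<inter> ?A) = x}) * (f (num_singletons P - x) / (card P choose 2))"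
      by simp
    also have "\<dots> = hyp2 (card P) (num_singletons P) x * f (num_singletons P - x)"
      using x by (subst card_subsets_meeting[OF fin]) (auto simp: hyp2_def num_singletons_eq)
    finally show "(\<Sum>D | D \<in> ?S \<and> card (D \<inter> ?A) = x. f (num_singletons P - card (D \<inter> ?A)) / (card P choose 2))
        = hyp2 (card P) (num_singletons P) x * f (num_singletons P - x)" .
  qed
  finally show ?thesis .
qed

lemma set_kchain:
  assumes "disjoint_blocks P" "card P = Suc m" "xs \<in> set_pmf (kchain m P)"
  shows "length xs = Suc m" "xs ! m = P"
    and "\<And>k. k \<le> m \<Longrightarrow> disjoint_blocks (xs ! k) \<and> card (xs ! k) = Suc k \<and> \<Union>(xs ! k) = \<Union>P"
    and "\<And>k l i. k \<le> l \<Longrightarrow> l \<le> m \<Longrightarrow> {i} \<in> xs ! k \<Longrightarrow> {i} \<in> xs ! l"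
proof -
  have "length xs = Suc m \<and> xs ! m = P \<and> (\<forall>k\<le>m. disjoint_blocks (xs ! k) \<and> card (xs ! k) = Suc k \<and> \<Union>(xs ! k) = \<Union>P) \<and>
     (\<forall>k l i. k \<le> l \<longrightarrow> l \<le> m \<longrightarrow> {i} \<in> xs ! k \<longrightarrow> {i} \<in> xs ! l)"
    using assms
  proof (induction m arbitrary: P xs)
    case 0
    then show ?case by auto
  next
    case (Suc m)
    from Suc.prems obtain Q ys where Q: "Q \<in> set_pmf (merge_step P)"
      and ys: "ys \<in> set_pmf (kchain m Q)" "xs = ys @ [P]"
      by auto
    then obtain D where D: "D \<subseteq> P" "card D = 2" "Q = P - D \<union> {\<Union>D}"
      using set_merge_step[OF Suc.prems(1)] Suc.prems(2) by auto
    note B = disjoint_blocks_merge[OF Suc.prems(1) D(1,2), folded D(3)]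
    have UQ: "\<Union>Q = \<Union>P" using D by auto
    have IH: "length ys = Suc m" "ys ! m = Q" "\<And>k. k \<le> m \<Longrightarrow> disjoint_blocks (ys ! k) \<and> card (ys ! k) = Suc k \<and> \<Union>(ys ! k) = \<Union>P"
      "\<And>k l i. k \<le> l \<Longrightarrow> l \<le> m \<Longrightarrow> {i} \<in> ys ! k \<Longrightarrow> {i} \<in> ys ! l"
      using Suc.IH[OF B(1) _ ys(1)] B(2) Suc.prems(2) UQ by auto
    have QP: "{i} \<in> P" if "{i} \<in> Q" for i using B(3) that by auto
    have "{i} \<in> xs ! l" if "k \<le> l" "l \<le> Suc m" "{i} \<in> xs ! k" for k l i
    proof (cases "l = Suc m")
      case True
      show ?thesis
      proof (cases "k = l")
        case False
        then have k: "k \<le> m" using that True by simp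
        then have "{i} \<in> ys ! k" using that IH(1) ys(2) by (simp add: nth_append)
        then have "{i} \<in> Q" using IH(4)[of k m] k IH(2) by simp
        then show ?thesis using True IH(1) ys(2) QP by (simp add: nth_append)
      qed (use that in auto)
    next
      case False
      then show ?thesis using that IH(1) IH(4)[of k l i] ys(2) by (simp add: nth_append)
    qed
    moreover have "disjoint_blocks (xs ! k) \<and> card (xs ! k) = Suc k \<and> \<Union>(xs ! k) = \<Union>P" if "k \<le> Suc m" for k
      using that IH(1,3) ys(2) Suc.prems by (cases "k = Suc m") (auto simp: nth_append)
    ultimately show ?case using IH(1) ys(2) by (auto simp: nth_append)
  qed
  then show "length xs = Suc m" "xs ! m = P"
    "\<And>k. k \<le> m \<Longrightarrow> disjoint_blocks (xs ! k) \<and> card (xs ! k) = Suc k \<and> \<Union>(xs ! k) = \<Union>P"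
    "\<And>k l i. k \<le> l \<Longrightarrow> l \<le> m \<Longrightarrow> {i} \<in> xs ! k \<Longrightarrow> {i} \<in> xs ! l"
    by auto
qed

lemma finite_set_kchain:
  assumes "disjoint_blocks P" "card P = Suc m"
  shows "finite (set_pmf (kchain m P))"
  using assms
proof (induction m arbitrary: P)
  case (Suc m)
  have S: "set_pmf (merge_step P) = (\<lambda>D. P - D \<union> {\<Union>D}) ` {D. D \<subseteq> P \<and> card D = 2}"
    using set_merge_step Suc.prems by simp
  have "finite (set_pmf (merge_step P))"
    unfolding S using Suc.prems pairs_finite_nonempty(1)[of P] by (simp add: disjoint_blocks_def)
  moreover have "finite (set_pmf (kchain m Q))" if "Q \<in> set_pmf (merge_step P)" for Q
    using that S disjoint_blocks_merge[OF Suc.prems(1)] Suc by auto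
  ultimately show ?case by simp
qed simp

text \<open>The index \<open>m\<close> counts mergers, so that the state \<open>v\<close> is the number of singletons among
  \<open>m + 1\<close> blocks.\<close>
fun chain_expectation :: "(nat \<Rightarrow> nat \<Rightarrow> complex) \<Rightarrow> nat \<Rightarrow> nat \<Rightarrow> complex" where
  "chain_expectation F 0 v = 1"
| "chain_expectation F (Suc m) v = F (Suc (Suc m)) v * (\<Sum>x\<le>2. hyp2 (Suc (Suc m)) v x * chain_expectation F m (v - x))"

lemma expectation_kchain_prod:
  assumes "disjoint_blocks P" "card P = Suc m"
  shows "measure_pmf.expectation (kchain m P) (\<lambda>xs. \<Prod>k=2..Suc m. F k (num_singletons (xs ! (k - 1)))) = chain_expectation F m (num_singletons P)"
  using assms
proof (induction m arbitrary: P)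
  case (Suc m)
  have S: "set_pmf (merge_step P) = (\<lambda>D. P - D \<union> {\<Union>D}) ` {D. D \<subseteq> P \<and> card D = 2}"
    using set_merge_step Suc.prems by simp
  have fin: "finite (set_pmf (merge_step P))"
    unfolding S using Suc.prems pairs_finite_nonempty(1)[of P] by (simp add: disjoint_blocks_def)
  have Q: "disjoint_blocks Q" "card Q = Suc m" if "Q \<in> set_pmf (merge_step P)" for Q
    using that S disjoint_blocks_merge[OF Suc.prems(1)] Suc.prems(2) by auto
  let ?c = "F (Suc (Suc m)) (num_singletons P)"
  let ?f = "\<lambda>m xs. \<Prod>k=2..Suc m. F k (num_singletons (xs ! (k - 1)))"
  have "measure_pmf.expectation (kchain (Suc m) P) (?f (Suc m))
      = (\<Sum>Q\<in>set_pmf (merge_step P). pmf (merge_step P) Q *\<^sub>R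
          measure_pmf.expectation (map_pmf (\<lambda>xs. xs @ [P]) (kchain m Q)) (?f (Suc m)))"
    unfolding kchain.simps using fin Q finite_set_kchain
    by (subst pmf_expectation_bind[of "set_pmf (merge_step P)"]) auto
  also have "\<dots> = (\<Sum>Q\<in>set_pmf (merge_step P). pmf (merge_step P) Q *\<^sub>R (?c * chain_expectation F m (num_singletons Q)))"
  proof (intro sum.cong refl arg_cong2[where f = scaleR])
    fix Q assume QQ: "Q \<in> set_pmf (merge_step P)"
    have "measure_pmf.expectation (map_pmf (\<lambda>xs. xs @ [P]) (kchain m Q)) (?f (Suc m))
       = measure_pmf.expectation (kchain m Q) (\<lambda>xs. ?f (Suc m) (xs @ [P]))"
      by simp
    also have "\<dots> = measure_pmf.expectation (kchain m Q) (\<lambda>xs. ?c * ?f m xs)"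
    proof (rule integral_cong_AE)
      show "AE xs in measure_pmf (kchain m Q). ?f (Suc m) (xs @ [P]) = ?c * ?f m xs"
      proof (rule AE_pmfI)
        fix xs assume "xs \<in> set_pmf (kchain m Q)"
        then have l: "length xs = Suc m" using set_kchain(1) Q[OF QQ] by blast
        have "?f (Suc m) (xs @ [P]) = F (Suc (Suc m)) (num_singletons ((xs @ [P]) ! (Suc (Suc m) - 1))) * ?f m (xs @ [P])"
          by (simp add: prod.nat_ivl_Suc' mult.commute)
        also have "?f m (xs @ [P]) = ?f m xs"
          using l by (intro prod.cong refl) (auto simp: nth_append)
        finally show "?f (Suc m) (xs @ [P]) = ?c * ?f m xs" using l by (simp add: nth_append)
      qed
    qed auto
    also have "\<dots> = ?c * chain_expectation F m (num_singletons Q)"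
      using Suc.IH[OF Q[OF QQ]] by simp
    finally show "measure_pmf.expectation (map_pmf (\<lambda>xs. xs @ [P]) (kchain m Q)) (?f (Suc m)) = ?c * chain_expectation F m (num_singletons Q)" .
  qed
  also have "\<dots> = measure_pmf.expectation (merge_step P) (\<lambda>Q. ?c * chain_expectation F m (num_singletons Q))"
    using fin by (subst integral_measure_pmf[of "set_pmf (merge_step P)"]) auto
  also have "\<dots> = ?c * measure_pmf.expectation (merge_step P) (\<lambda>Q. chain_expectation F m (num_singletons Q))"
    by simp
  also have "\<dots> = chain_expectation F (Suc m) (num_singletons P)"
    using Suc.prems by (subst expectation_merge_step) auto
  finally show ?case .
qed simp

lemma disjoint_blocks_singletons: "disjoint_blocks ((\<lambda>i. {i}) ` {1..n})" "card ((\<lambda>i. {i}) ` {1..n}) = n"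
  "num_singletons ((\<lambda>i. {i}) ` {1..n}) = n"
proof -
  show "disjoint_blocks ((\<lambda>i. {i}) ` {1..n})" by (auto simp: disjoint_blocks_def disjoint_def)
  show "card ((\<lambda>i. {i}) ` {1..n}) = n" by (simp add: card_image)
  have "{i. {i} \<in> (\<lambda>i. {i}) ` {1..n}} = {1..n}" by auto
  then show "num_singletons ((\<lambda>i. {i}) ` {1..n}) = n" by (simp add: num_singletons_def)
qed

lemma card_rho_less:
  assumes "xs \<in> set_pmf (coal_partitions n)" "2 \<le> k" "k \<le> n"
  shows "card {i \<in> {1..n}. rho n xs i < k} = num_singletons (xs ! (k - 1))"
proof -
  have n: "n = Suc (n - 1)" using assms by simp
  have K: "xs ! (n - 1) = (\<lambda>i. {i}) ` {1..n}"
    "\<And>k. k \<le> n - 1 \<Longrightarrow> disjoint_blocks (xs ! k) \<and> card (xs ! k) = Suc k \<and> \<Union>(xs ! k) = {1..n}"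
    "\<And>k l i. k \<le> l \<Longrightarrow> l \<le> n - 1 \<Longrightarrow> {i} \<in> xs ! k \<Longrightarrow> {i} \<in> xs ! l"
    using set_kchain[OF disjoint_blocks_singletons(1)[of n] _ assms(1)[unfolded coal_partitions_def]]
      disjoint_blocks_singletons(2)[of n] n by auto
  have root: "{i} \<notin> xs ! 0" for i
  proof
    assume i: "{i} \<in> xs ! 0"
    then have eq: "xs ! 0 = {{i}}"
      using K(2)[of 0] by (auto simp: card_1_singleton_iff)
    then have "{i} = {1..n}" using K(2)[of 0] by auto
    then have "card {1..n} = 1" by (metis card_1_singleton_iff One_nat_def)
    then show False using assms by simp
  qed
  have "rho n xs i < k \<longleftrightarrow> {i} \<in> xs ! (k - 1)" for i
  proof
    assume r: "rho n xs i < k"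
    show "{i} \<in> xs ! (k - 1)"
    proof (rule ccontr)
      assume "{i} \<notin> xs ! (k - 1)"
      then have "k \<in> {k \<in> {1..n}. {i} \<notin> xs ! (k - 1)}" using assms by auto
      then have "k \<le> rho n xs i" unfolding rho_def by (intro Max_ge) auto
      then show False using r by simp
    qed
  next
    assume i: "{i} \<in> xs ! (k - 1)"
    have "1 \<in> {k \<in> {1..n}. {i} \<notin> xs ! (k - 1)}" using root assms by auto
    then have "rho n xs i \<in> {k \<in> {1..n}. {i} \<notin> xs ! (k - 1)}"
      unfolding rho_def by (intro Max_in) auto
    then have *: "rho n xs i \<le> n" "{i} \<notin> xs ! (rho n xs i - 1)" by auto
    show "rho n xs i < k"
    proof (rule ccontr)
      assume "\<not> rho n xs i < k"
      then have "{i} \<in> xs ! (rho n xs i - 1)" using * by (intro K(3)[OF _ _ i]) auto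
      then show False using * by simp
    qed
  qed
  moreover have "{i \<in> {1..n}. {i} \<in> xs ! (k - 1)} = {i. {i} \<in> xs ! (k - 1)}"
    using K(3)[of "k - 1" "n - 1"] assms K(1) by fastforce
  ultimately show ?thesis by (simp add: num_singletons_def)
qed

subsection \<open>The characteristic function of the external length\<close>

lemma real_distribution_exp1: "real_distribution exp1"
proof -
  interpret prob_space exp1
    unfolding exp1_def by (rule prob_space_exponential_density) simp
  show ?thesis by standard (simp_all add: exp1_def)
qed

lemma prob_space_kingman: "prob_space (kingman n)"
proof -
  interpret E: real_distribution exp1 by (rule real_distribution_exp1)
  show ?thesis
    unfolding kingman_def
    by (intro prob_space_pair measure_pmf.prob_space_axioms prob_space_PiM E.prob_space_axioms)
qed

lemma ext_length_eq:
  "ext_length n \<omega> = (\<Sum>j=2..n. real (card {i \<in> {1..n}. rho n (fst \<omega>) i < j}) / real (j choose 2) * snd \<omega> j)"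
proof -
  have *: "coal_time n e k = (\<Sum>j=2..n. if k < j then e j / real (j choose 2) else 0)" for e k
  proof -
    have "(\<Sum>j=2..n. if k < j then e j / real (j choose 2) else 0)
        = (\<Sum>j\<in>{2..n} \<inter> {j. k < j}. e j / real (j choose 2))"
      by (simp add: sum.inter_restrict)
    also have "\<dots> = coal_time n e k"
      unfolding coal_time_def
    proof (rule sum.mono_neutral_left)
      show "\<forall>i\<in>{k + 1..n} - {2..n} \<inter> {j. k < j}. e i / real (i choose 2) = 0"
      proof
        fix i assume "i \<in> {k + 1..n} - {2..n} \<inter> {j. k < j}"
        then have "i < 2" by auto
        then show "e i / real (i choose 2) = 0" by (simp add: binomial_eq_0)
      qed
    qed auto
    finally show ?thesis by simp
  qed
  have "ext_length n \<omega> = (\<Sum>j=2..n. \<Sum>i=1..n. if rho n (fst \<omega>) i < j then snd \<omega> j / real (j choose 2) else 0)"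
    unfolding ext_length_def * by (rule sum.swap)
  also have "\<dots> = (\<Sum>j=2..n. real (card {i \<in> {1..n}. rho n (fst \<omega>) i < j}) / real (j choose 2) * snd \<omega> j)"
    by (intro sum.cong refl) (simp add: sum.If_cases Int_def)
  finally show ?thesis .
qed

lemma measurable_ext_length [measurable]: "ext_length n \<in> borel_measurable (kingman n)"
proof -
  have [measurable]: "(\<lambda>e. e j) \<in> borel_measurable (\<Pi>\<^sub>M j\<in>{2..n}. exp1)" if "j \<in> {2..n}" for j
  proof -
    have "(\<lambda>e. e j) \<in> measurable (\<Pi>\<^sub>M j\<in>{2..n}. exp1) exp1"
      using that by (rule measurable_component_singleton)
    then show ?thesis by (simp add: exp1_def)
  qed
  show ?thesis
    unfolding ext_length_eq[abs_def] kingman_def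
  proof (intro borel_measurable_sum borel_measurable_times)
    fix j assume j: "j \<in> {2..n}"
    show "(\<lambda>\<omega>. snd \<omega> j) \<in> borel_measurable (measure_pmf (coal_partitions n) \<Otimes>\<^sub>M (\<Pi>\<^sub>M j\<in>{2..n}. exp1))"
      using j by measurable
    have [measurable]: "(\<lambda>xs. real (card {i \<in> {1..n}. rho n xs i < j}) / real (j choose 2)) \<in> borel_measurable (measure_pmf (coal_partitions n))"
      by simp
    show "(\<lambda>\<omega>. real (card {i \<in> {1..n}. rho n (fst \<omega>) i < j}) / real (j choose 2))
      \<in> borel_measurable (measure_pmf (coal_partitions n) \<Otimes>\<^sub>M (\<Pi>\<^sub>M j\<in>{2..n}. exp1))"
      by measurable
  qed
qed

lemma char_kingman:
  assumes n: "2 \<le> n"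
  shows "char (distr (kingman n) borel (\<lambda>\<omega>. c * (ext_length n \<omega> - 2))) t
    = iexp (- 2 * (t * c)) * chain_expectation (\<lambda>k v. char exp1 (t * c * (v / (k choose 2)))) (n - 1) n"
proof -
  interpret E: real_distribution exp1 by (rule real_distribution_exp1)
  interpret PP: product_prob_space "\<lambda>_. exp1" "{2..n}" ..
  interpret PM: prob_space "\<Pi>\<^sub>M j\<in>{2..n}. exp1" by (rule prob_space_PiM) (rule E.prob_space_axioms)
  interpret pair_prob_space "measure_pmf (coal_partitions n)" "\<Pi>\<^sub>M j\<in>{2..n}. exp1" ..
  interpret K: prob_space "kingman n" by (rule prob_space_kingman)
  define w where "w xs j = t * c * (real (card {i \<in> {1..n}. rho n xs i < j}) / real (j choose 2))" for xs j
  have "char (distr (kingman n) borel (\<lambda>\<omega>. c * (ext_length n \<omega> - 2))) t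
      = (\<integral>\<omega>. iexp (t * (c * (ext_length n \<omega> - 2))) \<partial>kingman n)"
    unfolding char_def by (subst integral_distr) auto
  also have "\<dots> = (\<integral>\<omega>. iexp (- 2 * (t * c)) * iexp (t * c * ext_length n \<omega>) \<partial>kingman n)"
    by (intro Bochner_Integration.integral_cong refl) (simp add: exp_add[symmetric] algebra_simps)
  also have "\<dots> = iexp (- 2 * (t * c)) * (\<integral>\<omega>. iexp (t * c * ext_length n \<omega>) \<partial>kingman n)"
    by (rule integral_mult_right_zero)
  also have "(\<integral>\<omega>. iexp (t * c * ext_length n \<omega>) \<partial>kingman n)
     = (\<integral>xs. (\<integral>e. iexp (t * c * ext_length n (xs, e)) \<partial>(\<Pi>\<^sub>M j\<in>{2..n}. exp1)) \<partial>measure_pmf (coal_partitions n))"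
    unfolding kingman_def
    by (rule integral_fst'[symmetric], fold kingman_def, rule K.integrable_const_bound[where B = 1]) auto
  also have "\<dots> = (\<integral>xs. (\<Prod>j=2..n. char exp1 (w xs j)) \<partial>measure_pmf (coal_partitions n))"
  proof (rule Bochner_Integration.integral_cong[OF refl])
    fix xs
    have "(\<integral>e. iexp (t * c * ext_length n (xs, e)) \<partial>(\<Pi>\<^sub>M j\<in>{2..n}. exp1))
      = (\<integral>e. (\<Prod>j=2..n. iexp (w xs j * e j)) \<partial>(\<Pi>\<^sub>M j\<in>{2..n}. exp1))"
      by (intro Bochner_Integration.integral_cong refl)
        (simp add: exp_sum[symmetric] ext_length_eq w_def sum_distrib_left algebra_simps)
    also have "\<dots> = (\<Prod>j=2..n. \<integral>x. iexp (w xs j * x) \<partial>exp1)"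
      by (rule PP.product_integral_prod) (auto intro!: E.integrable_const_bound[where B = 1])
    finally show "(\<integral>e. iexp (t * c * ext_length n (xs, e)) \<partial>(\<Pi>\<^sub>M j\<in>{2..n}. exp1))
        = (\<Prod>j=2..n. char exp1 (w xs j))"
      by (simp add: char_def)
  qed
  also have "\<dots> = (\<integral>xs. (\<Prod>j=2..Suc (n - 1). char exp1 (t * c * (num_singletons (xs ! (j - 1)) / (j choose 2))))
      \<partial>measure_pmf (coal_partitions n))"
  proof (rule integral_cong_AE)
    show "AE xs in measure_pmf (coal_partitions n). (\<Prod>j=2..n. char exp1 (w xs j))
       = (\<Prod>j=2..Suc (n - 1). char exp1 (t * c * (num_singletons (xs ! (j - 1)) / (j choose 2))))"
    proof (rule AE_pmfI, rule prod.cong)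
      fix xs j assume xs: "xs \<in> set_pmf (coal_partitions n)" and j: "j \<in> {2..Suc (n - 1)}"
      then have "w xs j = t * c * (num_singletons (xs ! (j - 1)) / (j choose 2))"
        using card_rho_less[OF xs, of j] n unfolding w_def by auto
      then show "char exp1 (w xs j) = char exp1 (t * c * (num_singletons (xs ! (j - 1)) / (j choose 2)))" by simp
    qed (use n in auto)
  qed auto
  also have "\<dots> = chain_expectation (\<lambda>k v. char exp1 (t * c * (v / (k choose 2)))) (n - 1) n"
    unfolding coal_partitions_def
    using expectation_kchain_prod[OF disjoint_blocks_singletons(1)[of n], of "n - 1" "\<lambda>k v. char exp1 (t * c * (v / (k choose 2)))"]
      disjoint_blocks_singletons(2,3)[of n] n by simp
  finally show ?thesis .
qed

lemma char_exp1_bound: "cmod (char exp1 u * iexp (- u) - 1) \<le> 2 * u\<^sup>2"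
proof -
  interpret E: real_distribution exp1 by (rule real_distribution_exp1)
  have D: "distributed exp1 lborel (\<lambda>x. x) (exponential_density 1)"
    unfolding distributed_def exp1_def by (auto simp: distr_id2)
  have int: "integrable exp1 (\<lambda>x. x ^ k)" for k
    using E.erlang_ith_moment_integrable[OF _ D] by simp
  have ev: "E.expectation (\<lambda>x. x ^ k) = fact k" for k
    using E.erlang_ith_moment[OF _ D, of k] by simp
  have "cmod (char exp1 u - (\<Sum>k \<le> 1. ((\<i> * u)^k / fact k) * E.expectation (\<lambda>x. x^k))) \<le>
    (\<bar>u\<bar>^1 / fact (Suc 1)) * E.expectation (\<lambda>x. min (2 * \<bar>x\<bar>^1 * Suc 1) (\<bar>u\<bar> * \<bar>x\<bar>^Suc 1))"
    by (rule E.char_approx2) (rule int)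
  also have "\<dots> \<le> (\<bar>u\<bar>^1 / fact (Suc 1)) * E.expectation (\<lambda>x. \<bar>u\<bar> * x ^ 2)"
  proof (rule mult_left_mono, rule integral_mono)
    show "integrable exp1 (\<lambda>x. \<bar>u\<bar> * x ^ 2)" using int[of 2] by simp
    show "integrable exp1 (\<lambda>x. min (2 * \<bar>x\<bar>^1 * Suc 1) (\<bar>u\<bar> * \<bar>x\<bar>^Suc 1))"
      by (rule Bochner_Integration.integrable_bound[where f="\<lambda>x. \<bar>u\<bar> * x ^ 2"])
        (use int[of 2] in \<open>auto simp: power2_eq_square abs_mult\<close>)
  qed (auto simp: power2_eq_square)
  also have "\<dots> = u\<^sup>2" using ev[of 2] by (simp add: power2_eq_square)
  also have "(\<Sum>k \<le> 1. ((\<i> * u)^k / fact k) * E.expectation (\<lambda>x. x^k)) = 1 + \<i> * u"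
    using ev[of 1] ev[of 0] by simp
  finally have 1: "cmod (char exp1 u - (1 + \<i> * u)) \<le> u\<^sup>2" .
  have 2: "cmod (iexp u - (1 + \<i> * u)) \<le> u\<^sup>2 / 2"
    using iexp_approx1[of u 1] by (simp add: power2_eq_square)
  have "char exp1 u * iexp (- u) - 1 = iexp (- u) * (char exp1 u - iexp u)"
    by (simp add: algebra_simps exp_minus)
  then have "cmod (char exp1 u * iexp (- u) - 1) = cmod (char exp1 u - iexp u)"
    by (simp add: norm_mult)
  also have "\<dots> \<le> cmod (char exp1 u - (1 + \<i> * u)) + cmod (iexp u - (1 + \<i> * u))"
    using norm_triangle_ineq4[of "char exp1 u - (1 + \<i> * u)" "iexp u - (1 + \<i> * u)"] by simp
  finally show ?thesis using 1 2 zero_le_power2[of u] by linarith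
qed

subsection \<open>Hypergeometric increments\<close>

lemma sum_atMost_2: "(\<Sum>x\<le>(2::nat). f x) = f 0 + f 1 + (f 2 :: 'a::comm_monoid_add)"
  by (simp add: numeral_2_eq_2)

lemma real_choose_two: "real (n choose 2) = real n * (real n - 1) / 2"
proof (induction n)
  case (Suc n)
  have "Suc n choose 2 = n + (n choose 2)" by (simp add: numeral_2_eq_2)
  then show ?case using Suc by (simp add: field_simps)
qed simp

lemma hyp2_nonneg: "0 \<le> hyp2 j v x"
  by (simp add: hyp2_def)

lemma hyp2_values:
  assumes "v \<le> j"
  shows "hyp2 j v 0 = (real j - real v) * (real j - real v - 1) / (real j * (real j - 1))"
    "hyp2 j v 1 = 2 * real v * (real j - real v) / (real j * (real j - 1))"
    "hyp2 j v 2 = real v * (real v - 1) / (real j * (real j - 1))"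
  using assms by (simp_all add: hyp2_def real_choose_two of_nat_diff)

lemma hyp2_support:
  assumes "hyp2 j v x \<noteq> 0" "v \<le> j" "x \<le> 2"
  shows "x \<le> v" "v - x \<le> j - 1"
  using assms by (auto simp: hyp2_def binomial_eq_0_iff not_less)

lemma hyp2_sum:
  assumes "v \<le> j" "2 \<le> j"
  shows "(\<Sum>x\<le>2. hyp2 j v x) = 1"
proof -
  have "real j * (real j - 1) \<noteq> 0" using assms by simp
  then show ?thesis
    unfolding sum_atMost_2 hyp2_values[OF assms(1)] add_divide_distrib[symmetric]
    by (simp add: field_simps)
qed

lemma hyp2_mean_left:
  assumes "v \<le> j" "2 \<le> j"
  shows "(\<Sum>x\<le>2. hyp2 j v x * real (v - x)) = real v * (real j - 2) / real j"
proof -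
  have j: "real j \<noteq> 0" "real j - 1 \<noteq> 0" using assms by auto
  have "(\<Sum>x\<le>2. hyp2 j v x * real (v - x)) = (\<Sum>x\<le>2. hyp2 j v x * (real v - real x))"
    using hyp2_support(1)[OF _ assms(1)] by (intro sum.cong refl) (force simp: of_nat_diff)
  also have "\<dots> = real v * (real j - 2) / real j"
    unfolding sum_atMost_2 hyp2_values[OF assms(1)] using j
    by (simp add: divide_simps) (simp add: algebra_simps)
  finally show ?thesis .
qed

lemma hyp2_fact2_left:
  assumes "v \<le> j" "2 \<le> j"
  shows "(\<Sum>x\<le>2. hyp2 j v x * (real (v - x) * (real (v - x) - 1)))
    = real v * (real v - 1) * ((real j - 2) * (real j - 3) / (real j * (real j - 1)))"
proof -
  have j: "real j \<noteq> 0" "real j - 1 \<noteq> 0" using assms by auto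
  have "(\<Sum>x\<le>2. hyp2 j v x * (real (v - x) * (real (v - x) - 1)))
      = (\<Sum>x\<le>2. hyp2 j v x * ((real v - real x) * (real v - real x - 1)))"
    using hyp2_support(1)[OF _ assms(1)] by (intro sum.cong refl) (force simp: of_nat_diff)
  also have "\<dots> = real v * (real v - 1) * ((real j - 2) * (real j - 3) / (real j * (real j - 1)))"
    unfolding sum_atMost_2 hyp2_values[OF assms(1)] using j
    by (simp add: divide_simps) (simp add: algebra_simps)
  finally show ?thesis .
qed

lemma hyp2_centered:
  assumes "v \<le> j" "2 \<le> j"
  shows "(\<Sum>x\<le>2. hyp2 j v x * (real x - 2 * real v / real j)) = 0"
proof -
  have j: "real j \<noteq> 0" "real j - 1 \<noteq> 0" using assms by auto
  show ?thesis
    unfolding sum_atMost_2 hyp2_values[OF assms(1)] using j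
    by (simp add: divide_simps) (simp add: algebra_simps)
qed

lemma hyp2_variance:
  assumes "v \<le> j" "2 \<le> j"
  shows "(\<Sum>x\<le>2. hyp2 j v x * (real x - 2 * real v / real j)\<^sup>2)
    = 2 * real v / real j + 2 * (real v * (real v - 1) / (real j * (real j - 1))) - 4 * (real v)\<^sup>2 / (real j)\<^sup>2"
proof -
  have j: "real j \<noteq> 0" "real j - 1 \<noteq> 0" using assms by auto
  show ?thesis
    unfolding sum_atMost_2 hyp2_values[OF assms(1)] using j
    by (simp add: divide_simps) (simp add: algebra_simps power2_eq_square)
qed

lemma hyp2_variance_bounds:
  fixes v j :: nat
  assumes "v \<le> j" "2 \<le> j"
  defines "w \<equiv> (\<Sum>x\<le>2. hyp2 j v x * (real x - 2 * real v / real j)\<^sup>2)"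
  shows "0 \<le> w" "w \<le> 2 * real v / real j" "\<bar>w - 2 * real v / real j\<bar> \<le> 4 * (real v)\<^sup>2 / (real j)\<^sup>2"
proof -
  show "0 \<le> w" unfolding w_def by (intro sum_nonneg mult_nonneg_nonneg hyp2_nonneg) auto
  have j: "0 < real j" "0 < real j - 1" using assms by auto
  have p: "real v * (real v - 1) / (real j * (real j - 1)) \<le> (real v)\<^sup>2 / (real j)\<^sup>2"
  proof -
    have "real v * (real v - 1) * (real j)\<^sup>2 \<le> (real v)\<^sup>2 * (real j * (real j - 1))"
    proof -
      have "(real v)\<^sup>2 * (real j * (real j - 1)) - real v * (real v - 1) * (real j)\<^sup>2
          = real v * real j * (real j - real v)"
        by (simp add: algebra_simps power2_eq_square)
      moreover have "0 \<le> real v * real j * (real j - real v)" using assms by simp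
      ultimately show ?thesis by linarith
    qed
    then show ?thesis using j by (simp add: divide_simps)
  qed
  have p0: "0 \<le> real v * (real v - 1) / (real j * (real j - 1))"
    using j by (cases v) auto
  have q: "0 \<le> (real v)\<^sup>2 / (real j)\<^sup>2" by simp
  have w: "w = 2 * real v / real j + 2 * (real v * (real v - 1) / (real j * (real j - 1))) - 4 * ((real v)\<^sup>2 / (real j)\<^sup>2)"
    unfolding w_def hyp2_variance[OF assms(1,2)] by simp
  show "w \<le> 2 * real v / real j" using w p q by linarith
  show "\<bar>w - 2 * real v / real j\<bar> \<le> 4 * (real v)\<^sup>2 / (real j)\<^sup>2"
    using w p p0 q by (simp add: abs_le_iff)
qed

lemma hyp2_char_bound:
  fixes y :: real
  assumes "v \<le> j" "2 \<le> j"
  defines "w \<equiv> (\<Sum>x\<le>2. hyp2 j v x * (real x - 2 * real v / real j)\<^sup>2)"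
  shows "cmod ((\<Sum>x\<le>2. hyp2 j v x * iexp (- y * (real x - 2 * real v / real j))) - (1 - y\<^sup>2 * w / 2))
    \<le> \<bar>y\<bar> ^ 3 * (2 * real v / (3 * real j))"
proof -
  define d where "d x = real x - 2 * real v / real j" for x :: nat
  have q: "0 \<le> 2 * real v / real j" "2 * real v / real j \<le> 2" using assms by (auto simp: divide_simps)
  have dle: "\<bar>d x\<bar> \<le> 2" if "x \<le> 2" for x
  proof -
    have "real x \<le> 2" "0 \<le> real x" using that by auto
    then show ?thesis using q unfolding d_def by linarith
  qed
  have c: "(\<Sum>x\<le>2. hyp2 j v x) = 1" "(\<Sum>x\<le>2. hyp2 j v x * d x) = 0" "(\<Sum>x\<le>2. hyp2 j v x * (d x)\<^sup>2) = w"
    unfolding d_def w_def using hyp2_sum hyp2_centered assms by auto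
  have "complex_of_real (1 - y\<^sup>2 * w / 2) = complex_of_real (\<Sum>x\<le>2. hyp2 j v x) - \<i> * y * complex_of_real (\<Sum>x\<le>2. hyp2 j v x * d x)
      - y\<^sup>2 / 2 * complex_of_real (\<Sum>x\<le>2. hyp2 j v x * (d x)\<^sup>2)"
    unfolding c by simp
  also have "\<dots> = (\<Sum>x\<le>2. hyp2 j v x * (1 - \<i> * y * d x - y\<^sup>2 / 2 * (d x)\<^sup>2))"
    by (simp add: sum_subtractf sum.distrib sum_distrib_left algebra_simps sum_divide_distrib)
  finally have X: "complex_of_real (1 - y\<^sup>2 * w / 2) = (\<Sum>x\<le>2. hyp2 j v x * (1 - \<i> * y * d x - y\<^sup>2 / 2 * (d x)\<^sup>2))" .
  have eq: "(\<Sum>x\<le>2. hyp2 j v x * iexp (- y * d x)) - complex_of_real (1 - y\<^sup>2 * w / 2)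
      = (\<Sum>x\<le>2. hyp2 j v x * (iexp (- y * d x) - (1 - \<i> * y * d x - y\<^sup>2 / 2 * (d x)\<^sup>2)))"
    unfolding X by (simp only: sum_subtractf[symmetric] right_diff_distrib[symmetric])
  have T: "cmod (iexp (- y * d x) - (1 - \<i> * y * d x - y\<^sup>2 / 2 * (d x)\<^sup>2)) \<le> \<bar>y\<bar> ^ 3 / 3 * (d x)\<^sup>2" if "x \<le> 2" for x
  proof -
    have "cmod (iexp (- y * d x) - (1 - \<i> * y * d x - y\<^sup>2 / 2 * (d x)\<^sup>2)) \<le> \<bar>- y * d x\<bar> ^ 3 / 6"
      using iexp_approx1[of "- y * d x" 2]
      by (simp add: sum_atMost_2 power_mult_distrib algebra_simps eval_nat_numeral)
    also have "\<dots> = \<bar>y\<bar> ^ 3 / 6 * (\<bar>d x\<bar> * (d x)\<^sup>2)"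
    proof -
      have "\<bar>d x\<bar> ^ 3 = \<bar>d x\<bar> * \<bar>d x\<bar>\<^sup>2" by (simp only: power3_eq_cube power2_eq_square mult.assoc)
      then show ?thesis by (simp add: abs_mult power_mult_distrib)
    qed
    also have "\<dots> \<le> \<bar>y\<bar> ^ 3 / 6 * (2 * (d x)\<^sup>2)"
      using dle[OF that] by (intro mult_left_mono mult_right_mono) auto
    finally show ?thesis by simp
  qed
  have "cmod ((\<Sum>x\<le>2. hyp2 j v x * iexp (- y * d x)) - complex_of_real (1 - y\<^sup>2 * w / 2))
      \<le> (\<Sum>x\<le>2. hyp2 j v x * (\<bar>y\<bar> ^ 3 / 3 * (d x)\<^sup>2))"
    unfolding eq by (rule sum_norm_le, simp only: norm_mult norm_of_real abs_of_nonneg[OF hyp2_nonneg])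
      (intro mult_left_mono T hyp2_nonneg, simp)
  also have "\<dots> = \<bar>y\<bar> ^ 3 / 3 * w"
    unfolding c(3)[symmetric] by (simp add: sum_distrib_left algebra_simps)
  also have "\<dots> \<le> \<bar>y\<bar> ^ 3 / 3 * (2 * real v / real j)"
    using hyp2_variance_bounds(2)[OF assms(1,2)] unfolding w_def by (intro mult_left_mono) auto
  finally show ?thesis unfolding d_def by simp
qed

lemma exp_minus_quadratic:
  fixes r :: real
  assumes "0 \<le> r"
  shows "\<bar>exp (- r) - (1 - r)\<bar> \<le> r\<^sup>2 / 2"
proof -
  have "1 - r \<le> exp (- r)" using exp_ge_add_one_self[of "- r"] by simp
  moreover have "exp (- r) \<le> 1 - r + r\<^sup>2 / 2"
  proof -
    have "(\<lambda>r. exp (- r) - (1 - r + r\<^sup>2 / 2)) r \<le> (\<lambda>r. exp (- r) - (1 - r + r\<^sup>2 / 2)) 0"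
    proof (rule DERIV_nonpos_imp_nonincreasing[OF assms])
      fix x :: real assume "0 \<le> x" "x \<le> r"
      have "((\<lambda>r. exp (- r) - (1 - r + r\<^sup>2 / 2)) has_real_derivative (1 - x - exp (- x))) (at x)"
        by (auto intro!: derivative_eq_intros)
      moreover have "1 - x - exp (- x) \<le> 0" using exp_ge_add_one_self[of "- x"] by simp
      ultimately show "\<exists>y. ((\<lambda>r. exp (- r) - (1 - r + r\<^sup>2 / 2)) has_real_derivative y) (at x) \<and> y \<le> 0"
        by blast
    qed
    then show ?thesis by simp
  qed
  ultimately show ?thesis by (simp add: abs_le_iff)
qed

lemma step_char_bound:
  fixes y e \<epsilon> r :: real and z :: complex
  assumes v: "v \<le> j" "2 \<le> j" and e: "0 \<le> e" "0 < \<epsilon>"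
    and z: "cmod (z - 1) \<le> 2 * (y * real v / real j)\<^sup>2"
    and r: "r = y\<^sup>2 * e / real j"
  shows "cmod ((\<Sum>x\<le>2. hyp2 j v x * (z * iexp (- y * (real x - 2 * real v / real j)))) - exp (- r))
    \<le> (y\<^sup>2 / (2 * real j) * (\<epsilon> * e\<^sup>2 + 1 / \<epsilon>) + r\<^sup>2 / 2)
      + (2 * \<bar>y\<bar> ^ 3 / (3 * real j) + 4 * y\<^sup>2 / (real j)\<^sup>2 + y\<^sup>2 / (2 * real j) * \<epsilon> * (1 - 2 * e)) * real v
      + (4 * y\<^sup>2 / (real j)\<^sup>2 + y\<^sup>2 / (2 * real j) * \<epsilon>) * (real v * (real v - 1))"
proof -
  define w where "w = (\<Sum>x\<le>2. hyp2 j v x * (real x - 2 * real v / real j)\<^sup>2)"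
  define S where "S = (\<Sum>x\<le>2. hyp2 j v x * iexp (- y * (real x - 2 * real v / real j)))"
  have j: "0 < real j" using v by simp
  have r0: "0 \<le> r" using r e j by simp
  have Sle: "cmod S \<le> 1"
  proof -
    have "cmod S \<le> (\<Sum>x\<le>2. hyp2 j v x)"
      unfolding S_def by (rule sum_norm_le) (simp add: norm_mult hyp2_nonneg)
    then show ?thesis using hyp2_sum[OF v] by simp
  qed
  have 1: "cmod (z * S - S) \<le> 2 * (y * real v / real j)\<^sup>2"
  proof -
    have "cmod (z * S - S) = cmod (z - 1) * cmod S"
      by (simp add: norm_mult[symmetric] algebra_simps)
    also have "\<dots> \<le> 2 * (y * real v / real j)\<^sup>2 * 1" using z Sle by (intro mult_mono) auto
    finally show ?thesis by simp
  qed
  have 2: "cmod (S - complex_of_real (1 - y\<^sup>2 * w / 2)) \<le> \<bar>y\<bar> ^ 3 * (2 * real v / (3 * real j))"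
    unfolding S_def w_def using hyp2_char_bound[OF v] by simp
  have 3: "\<bar>(1 - y\<^sup>2 * w / 2) - (1 - r)\<bar> \<le> 2 * (y * real v / real j)\<^sup>2 + y\<^sup>2 / (2 * real j) * (\<epsilon> * (real v - e)\<^sup>2 + 1 / \<epsilon>)"
  proof -
    have am: "2 * \<bar>real v - e\<bar> \<le> \<epsilon> * (real v - e)\<^sup>2 + 1 / \<epsilon>"
    proof -
      have "0 \<le> (\<epsilon> * \<bar>real v - e\<bar> - 1)\<^sup>2 / \<epsilon>" using e by simp
      also have "\<dots> = \<epsilon> * (real v - e)\<^sup>2 + 1 / \<epsilon> - 2 * \<bar>real v - e\<bar>"
        using e(2) by (simp add: power2_diff power_mult_distrib field_simps) (simp add: power2_eq_square)
      finally show ?thesis by simp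
    qed
    have E: "(1 - y\<^sup>2 * w / 2) - (1 - r) = y\<^sup>2 / 2 * ((2 * e / real j - 2 * real v / real j) - (w - 2 * real v / real j))"
      using j by (simp add: r field_simps)
    have "\<bar>(1 - y\<^sup>2 * w / 2) - (1 - r)\<bar> = y\<^sup>2 / 2 * \<bar>(2 * e / real j - 2 * real v / real j) - (w - 2 * real v / real j)\<bar>"
      unfolding E abs_mult by simp
    also have "\<dots> \<le> y\<^sup>2 / 2 * (\<bar>2 * e / real j - 2 * real v / real j\<bar> + \<bar>w - 2 * real v / real j\<bar>)"
      by (intro mult_left_mono) auto
    also have "\<bar>2 * e / real j - 2 * real v / real j\<bar> = 2 * \<bar>real v - e\<bar> / real j"
    proof -
      have E2: "2 * e / real j - 2 * real v / real j = (2 / real j) * (e - real v)"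
        by (simp add: algebra_simps diff_divide_distrib)
      show ?thesis unfolding E2 abs_mult by (simp add: abs_minus_commute)
    qed
    also have "y\<^sup>2 / 2 * (2 * \<bar>real v - e\<bar> / real j + \<bar>w - 2 * real v / real j\<bar>)
        \<le> y\<^sup>2 / 2 * ((\<epsilon> * (real v - e)\<^sup>2 + 1 / \<epsilon>) / real j + 4 * (real v)\<^sup>2 / (real j)\<^sup>2)"
      using am j hyp2_variance_bounds(3)[OF v]
      by (intro mult_left_mono add_mono divide_right_mono) (auto simp: w_def)
    also have "\<dots> = 2 * (y * real v / real j)\<^sup>2 + y\<^sup>2 / (2 * real j) * (\<epsilon> * (real v - e)\<^sup>2 + 1 / \<epsilon>)"
      by (simp add: algebra_simps power_divide power_mult_distrib add_divide_distrib)
    finally show ?thesis .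
  qed
  have 4: "\<bar>(1 - r) - exp (- r)\<bar> \<le> r\<^sup>2 / 2" using exp_minus_quadratic[OF r0] by (simp add: abs_minus_commute)
  have zS: "(\<Sum>x\<le>2. hyp2 j v x * (z * iexp (- y * (real x - 2 * real v / real j)))) = z * S"
    unfolding S_def by (simp add: sum_distrib_left algebra_simps)
  have "cmod (z * S - exp (- r)) \<le> cmod (z * S - S) + cmod (S - complex_of_real (1 - y\<^sup>2 * w / 2))
      + (\<bar>(1 - y\<^sup>2 * w / 2) - (1 - r)\<bar> + \<bar>(1 - r) - exp (- r)\<bar>)"
  proof -
    have "z * S - exp (- r) = (z * S - S) + (S - complex_of_real (1 - y\<^sup>2 * w / 2)) + complex_of_real ((1 - y\<^sup>2 * w / 2) - exp (- r))"
      by simp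
    also have "cmod \<dots> \<le> cmod (z * S - S) + cmod (S - complex_of_real (1 - y\<^sup>2 * w / 2)) + cmod (complex_of_real ((1 - y\<^sup>2 * w / 2) - exp (- r)))"
      by (intro norm_triangle_le add_mono order_refl norm_triangle_ineq)
    also have "cmod (complex_of_real ((1 - y\<^sup>2 * w / 2) - exp (- r))) \<le> \<bar>(1 - y\<^sup>2 * w / 2) - (1 - r)\<bar> + \<bar>(1 - r) - exp (- r)\<bar>"
      by (simp only: norm_of_real)
    finally show ?thesis by simp
  qed
  then have "cmod ((\<Sum>x\<le>2. hyp2 j v x * (z * iexp (- y * (real x - 2 * real v / real j)))) - exp (- r))
     \<le> 2 * (y * real v / real j)\<^sup>2 + \<bar>y\<bar> ^ 3 * (2 * real v / (3 * real j))
      + (2 * (y * real v / real j)\<^sup>2 + y\<^sup>2 / (2 * real j) * (\<epsilon> * (real v - e)\<^sup>2 + 1 / \<epsilon>) + r\<^sup>2 / 2)"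
    unfolding zS using 1 2 3 4 by linarith
  also have "\<dots> = (y\<^sup>2 / (2 * real j) * (\<epsilon> * e\<^sup>2 + 1 / \<epsilon>) + r\<^sup>2 / 2)
      + (2 * \<bar>y\<bar> ^ 3 / (3 * real j) + 4 * y\<^sup>2 / (real j)\<^sup>2 + y\<^sup>2 / (2 * real j) * \<epsilon> * (1 - 2 * e)) * real v
      + (4 * y\<^sup>2 / (real j)\<^sup>2 + y\<^sup>2 / (2 * real j) * \<epsilon>) * (real v * (real v - 1))"
    by (simp add: algebra_simps power_divide power_mult_distrib add_divide_distrib diff_divide_distrib power2_eq_square)
  finally show ?thesis .
qed

text \<open>Along the chain, \<open>V\<^sub>k / (k (k - 1))\<close> and \<open>V\<^sub>k (V\<^sub>k - 1) / (k (k - 1)\<^sup>2 (k - 2))\<close> are martingales,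
  so one-step errors that are quadratic in the number of singletons add up explicitly.\<close>
lemma recursion_bound:
  fixes H :: "nat \<Rightarrow> nat \<Rightarrow> complex" and \<psi> :: "nat \<Rightarrow> nat \<Rightarrow> nat \<Rightarrow> complex" and a b c q :: "nat \<Rightarrow> real"
  defines "k1 \<equiv> \<lambda>n. real n * (real n - 1)" and "k2 \<equiv> \<lambda>n. real n * (real n - 1)\<^sup>2 * (real n - 2)"
  assumes m: "3 \<le> m" "m \<le> n"
    and base: "\<And>v. v \<le> m \<Longrightarrow> cmod (H m v - 1) \<le> 2 * real v"
    and step: "\<And>j v. m \<le> j \<Longrightarrow> v \<le> Suc j \<Longrightarrow> H (Suc j) v = (\<Sum>x\<le>2. hyp2 (Suc j) v x * (\<psi> (Suc j) v x * H j (v - x)))"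
    and psi: "\<And>j v x. cmod (\<psi> j v x) \<le> 1"
    and q: "\<And>j. m < j \<Longrightarrow> \<bar>q j\<bar> \<le> 1"
    and err: "\<And>j v. m < j \<Longrightarrow> v \<le> j \<Longrightarrow>
        cmod ((\<Sum>x\<le>2. hyp2 j v x * \<psi> j v x) - q j) \<le> a j + b j * real v + c j * (real v * (real v - 1))"
    and v: "v \<le> n"
  shows "cmod (H n v - (\<Prod>j\<in>{m<..n}. q j)) \<le>
    (\<Sum>j\<in>{m<..n}. a j) + (2 * k1 m + (\<Sum>j\<in>{m<..n}. b j * k1 j)) / k1 n * real v
      + (\<Sum>j\<in>{m<..n}. c j * k2 j) / k2 n * (real v * (real v - 1))"
  using m(2) v
proof (induction n arbitrary: v rule: dec_induct)
  case base
  have "k1 m \<noteq> 0" using m(1) by (simp add: k1_def)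
  then show ?case using \<open>v \<le> m\<close> assms(5)[of v] by simp
next
  case (step n)
  define \<alpha> where "\<alpha> = (\<Sum>j\<in>{m<..n}. a j)"
  define \<beta> where "\<beta> = (2 * k1 m + (\<Sum>j\<in>{m<..n}. b j * k1 j))"
  define \<gamma> where "\<gamma> = (\<Sum>j\<in>{m<..n}. c j * k2 j)"
  define Q where "Q = (\<Prod>j\<in>{m<..n}. q j)"
  let ?N = "Suc n"
  have n3: "3 \<le> n" using m(1) step.hyps by simp
  have set: "{m<..Suc n} = insert (Suc n) {m<..n}" using step.hyps by auto
  have Q: "\<bar>Q\<bar> \<le> 1"
    unfolding Q_def abs_prod by (rule prod_le_1) (use q in auto)
  have IH: "cmod (H n u - Q) \<le> \<alpha> + \<beta> / k1 n * real u + \<gamma> / k2 n * (real u * (real u - 1))" if "u \<le> n" for u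
    unfolding \<alpha>_def \<beta>_def \<gamma>_def Q_def using step.IH[OF that] by simp
  have eq: "H ?N v - complex_of_real (q ?N * Q)
      = (\<Sum>x\<le>2. hyp2 ?N v x * (\<psi> ?N v x * (H n (v - x) - Q))) + Q * ((\<Sum>x\<le>2. hyp2 ?N v x * \<psi> ?N v x) - q ?N)"
    unfolding assms(6)[OF step.hyps(1) step.prems]
    by (simp add: sum_subtractf sum_distrib_left algebra_simps)
  have 1: "cmod (\<Sum>x\<le>2. hyp2 ?N v x * (\<psi> ?N v x * (H n (v - x) - Q)))
     \<le> (\<Sum>x\<le>2. hyp2 ?N v x * (\<alpha> + \<beta> / k1 n * real (v - x) + \<gamma> / k2 n * (real (v - x) * (real (v - x) - 1))))"
  proof (rule sum_norm_le)
    fix x :: nat assume x: "x \<in> {..2}"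
    show "cmod (hyp2 ?N v x * (\<psi> ?N v x * (H n (v - x) - Q)))
       \<le> hyp2 ?N v x * (\<alpha> + \<beta> / k1 n * real (v - x) + \<gamma> / k2 n * (real (v - x) * (real (v - x) - 1)))"
    proof (cases "hyp2 ?N v x = 0")
      case False
      then have "v - x \<le> n" using hyp2_support(2)[OF False step.prems] x by simp
      have "cmod (\<psi> ?N v x * (H n (v - x) - Q)) \<le> 1 * cmod (H n (v - x) - Q)"
        unfolding norm_mult by (intro mult_right_mono psi) auto
      also have "\<dots> \<le> \<alpha> + \<beta> / k1 n * real (v - x) + \<gamma> / k2 n * (real (v - x) * (real (v - x) - 1))"
        using IH[OF \<open>v - x \<le> n\<close>] by simp
      finally show ?thesis
        unfolding norm_mult[of "complex_of_real (hyp2 ?N v x)"] by (simp add: hyp2_nonneg mult_left_mono)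
    qed simp
  qed
  have "(\<Sum>x\<le>2. hyp2 ?N v x * (\<alpha> + \<beta> / k1 n * real (v - x) + \<gamma> / k2 n * (real (v - x) * (real (v - x) - 1))))
     = \<alpha> * (\<Sum>x\<le>2. hyp2 ?N v x) + \<beta> / k1 n * (\<Sum>x\<le>2. hyp2 ?N v x * real (v - x))
      + \<gamma> / k2 n * (\<Sum>x\<le>2. hyp2 ?N v x * (real (v - x) * (real (v - x) - 1)))"
    by (simp only: sum_distrib_left distrib_left sum.distrib) (simp add: algebra_simps)
  also have "\<dots> = \<alpha> + \<beta> / k1 ?N * real v + \<gamma> / k2 ?N * (real v * (real v - 1))"
  proof -
    have N2: "2 \<le> ?N" using n3 by simp
    have r3: "real n \<ge> 3" using n3 by simp
    then have nz: "real n \<noteq> 0" "real n - 1 \<noteq> 0" "real n - 2 \<noteq> 0" "real n + 1 \<noteq> 0" by auto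
    have A: "\<beta> / k1 n * (real v * (real ?N - 2) / real ?N) = \<beta> / k1 ?N * real v"
      unfolding k1_def using nz by (simp add: divide_simps)
    have "(real ?N - 2) * (real ?N - 3) / (real ?N * (real ?N - 1)) / k2 n = 1 / k2 ?N"
      unfolding k2_def using nz by (simp add: divide_simps) (simp add: algebra_simps power2_eq_square)
    then have B: "\<gamma> / k2 n * (real v * (real v - 1) * ((real ?N - 2) * (real ?N - 3) / (real ?N * (real ?N - 1))))
       = \<gamma> / k2 ?N * (real v * (real v - 1))"
      by (metis (no_types, opaque_lifting) mult.commute mult.left_commute times_divide_eq_right times_divide_eq_left mult_1)
    show ?thesis
      unfolding hyp2_sum[OF step.prems N2] hyp2_mean_left[OF step.prems N2] hyp2_fact2_left[OF step.prems N2] A B by simp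
  qed
  finally have 2: "cmod (\<Sum>x\<le>2. hyp2 ?N v x * (\<psi> ?N v x * (H n (v - x) - Q)))
      \<le> \<alpha> + \<beta> / k1 ?N * real v + \<gamma> / k2 ?N * (real v * (real v - 1))" using 1 by simp
  have 3: "cmod (Q * ((\<Sum>x\<le>2. hyp2 ?N v x * \<psi> ?N v x) - q ?N)) \<le> a ?N + b ?N * real v + c ?N * (real v * (real v - 1))"
  proof -
    have "cmod (Q * ((\<Sum>x\<le>2. hyp2 ?N v x * \<psi> ?N v x) - q ?N)) \<le> 1 * cmod ((\<Sum>x\<le>2. hyp2 ?N v x * \<psi> ?N v x) - q ?N)"
      unfolding norm_mult using Q by (intro mult_right_mono) auto
    also have "\<dots> \<le> a ?N + b ?N * real v + c ?N * (real v * (real v - 1))"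
      using err[of ?N v] step by simp
    finally show ?thesis .
  qed
  have P: "(\<Prod>j\<in>{m<..?N}. q j) = q ?N * Q" unfolding set Q_def by simp
  have "(\<Sum>j\<in>{m<..?N}. a j) + (2 * k1 m + (\<Sum>j\<in>{m<..?N}. b j * k1 j)) / k1 ?N * real v
      + (\<Sum>j\<in>{m<..?N}. c j * k2 j) / k2 ?N * (real v * (real v - 1))
    = (\<alpha> + \<beta> / k1 ?N * real v + \<gamma> / k2 ?N * (real v * (real v - 1))) + (a ?N + b ?N * real v + c ?N * (real v * (real v - 1)))"
  proof -
    have "real n \<ge> 3" using n3 by simp
    then have "k1 ?N \<noteq> 0" "k2 ?N \<noteq> 0" unfolding k1_def k2_def by auto
    moreover have "(\<Sum>j\<in>{m<..?N}. a j) = \<alpha> + a ?N" "2 * k1 m + (\<Sum>j\<in>{m<..?N}. b j * k1 j) = \<beta> + b ?N * k1 ?N"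
      "(\<Sum>j\<in>{m<..?N}. c j * k2 j) = \<gamma> + c ?N * k2 ?N"
      unfolding set \<alpha>_def \<beta>_def \<gamma>_def by simp_all
    ultimately show ?thesis by (simp only:) (simp add: add_divide_distrib algebra_simps)
  qed
  then show ?case unfolding P eq using 2 3 by (intro norm_triangle_le) simp
qed

subsection \<open>Comparison with the Gaussian factor\<close>

lemma cmod_chain_expectation_le_1:
  assumes "\<And>k v. cmod (F k v) \<le> 1" "v \<le> Suc m"
  shows "cmod (chain_expectation F m v) \<le> 1"
  using assms(2)
proof (induction m arbitrary: v)
  case (Suc m)
  have "cmod (\<Sum>x\<le>2. hyp2 (Suc (Suc m)) v x * chain_expectation F m (v - x)) \<le> (\<Sum>x\<le>2. hyp2 (Suc (Suc m)) v x)"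
  proof (rule sum_norm_le)
    fix x :: nat assume x: "x \<in> {..2}"
    show "cmod (hyp2 (Suc (Suc m)) v x * chain_expectation F m (v - x)) \<le> hyp2 (Suc (Suc m)) v x"
    proof (cases "hyp2 (Suc (Suc m)) v x = 0")
      case False
      have "v - x \<le> Suc m" using hyp2_support(2)[OF False Suc.prems] x by simp
      from Suc.IH[OF this] show ?thesis
        using hyp2_nonneg[of "Suc (Suc m)" v x] by (simp add: norm_mult mult_left_le)
    qed simp
  qed
  also have "\<dots> = 1" using Suc.prems by (intro hyp2_sum) auto
  finally show ?case
    using assms(1)[of "Suc (Suc m)" v] by (simp add: norm_mult mult_le_one)
qed simp

lemma chain_expectation_zero:
  assumes "\<And>k. F k 0 = 1"
  shows "chain_expectation F m 0 = 1"
proof (induction m)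
  case (Suc m)
  have "(\<Sum>x\<le>2. hyp2 (Suc (Suc m)) 0 x * chain_expectation F m (0 - x)) = complex_of_real (\<Sum>x\<le>2. hyp2 (Suc (Suc m)) 0 x)"
    by (simp add: Suc)
  also have "\<dots> = 1" by (subst hyp2_sum) auto
  finally show ?case using assms by simp
qed simp

lemma sum_inverse_squares_le:
  assumes "2 \<le> m" "m \<le> n"
  shows "(\<Sum>j\<in>{m<..n}. 1 / (real j - 1)\<^sup>2) \<le> 2 / real m"
proof -
  have "(\<Sum>j\<in>{m<..n}. 1 / (real j - 1)\<^sup>2) \<le> 1 / (real m - 1) - 1 / (real n - 1)"
    using assms(2)
  proof (induction n rule: dec_induct)
    case (step n)
    have n: "real n > 1" using assms step.hyps by simp
    have "{m<..Suc n} = insert (Suc n) {m<..n}" using step.hyps by auto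
    then have "(\<Sum>j\<in>{m<..Suc n}. 1 / (real j - 1)\<^sup>2) = 1 / (real n)\<^sup>2 + (\<Sum>j\<in>{m<..n}. 1 / (real j - 1)\<^sup>2)" by simp
    also have "1 / (real n)\<^sup>2 \<le> 1 / (real n - 1) - 1 / real n"
    proof -
      have "1 / (real n - 1) - 1 / real n = 1 / (real n * (real n - 1))" using n by (simp add: field_simps)
      moreover have "1 / (real n)\<^sup>2 \<le> 1 / (real n * (real n - 1))"
        using n by (intro divide_left_mono) (auto simp: power2_eq_square)
      ultimately show ?thesis by simp
    qed
    finally show ?case using step.IH by simp
  qed simp
  also have "\<dots> \<le> 1 / (real m - 1)" using assms by simp
  also have "\<dots> \<le> 2 / real m" using assms by (simp add: divide_simps)
  finally show ?thesis .
qed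

lemma harmonic_block_bounds:
  assumes "1 \<le> m" "m \<le> n"
  shows "ln (real n) - ln (real m) \<le> (\<Sum>j\<in>{m<..n}. 1 / (real j - 1))"
    "(\<Sum>j\<in>{m<..n}. 1 / (real j - 1)) \<le> ln (real n) - ln (real m) + 1 / real m"
proof -
  have "ln (real n) - ln (real m) \<le> (\<Sum>j\<in>{m<..n}. 1 / (real j - 1)) \<and>
    (\<Sum>j\<in>{m<..n}. 1 / (real j - 1)) \<le> ln (real n) - ln (real m) + 1 / real m - 1 / real n"
    using assms(2)
  proof (induction n rule: dec_induct)
    case (step n)
    have n: "real n > 0" using assms step.hyps by simp
    have "{m<..Suc n} = insert (Suc n) {m<..n}" using step.hyps by auto
    then have s: "(\<Sum>j\<in>{m<..Suc n}. 1 / (real j - 1)) = 1 / real n + (\<Sum>j\<in>{m<..n}. 1 / (real j - 1))" by simp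
    have "ln (real (Suc n) / real n) \<le> real (Suc n) / real n - 1"
      using n by (intro ln_le_minus_one) simp
    then have 1: "ln (real (Suc n)) - ln (real n) \<le> 1 / real n" using n by (simp add: ln_div field_simps)
    have "ln (real n / real (Suc n)) \<le> real n / real (Suc n) - 1"
      using n by (intro ln_le_minus_one) simp
    then have 2: "1 / real (Suc n) \<le> ln (real (Suc n)) - ln (real n)" using n by (simp add: ln_div field_simps)
    show ?case unfolding s using step.IH 1 2 by linarith
  qed simp
  moreover have "0 \<le> 1 / real n" by simp
  ultimately show "ln (real n) - ln (real m) \<le> (\<Sum>j\<in>{m<..n}. 1 / (real j - 1))"
    "(\<Sum>j\<in>{m<..n}. 1 / (real j - 1)) \<le> ln (real n) - ln (real m) + 1 / real m"
    by linarith+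
qed

lemma step_error_total:
  fixes j N :: real and \<tau> :: real
  assumes j: "3 < j" "j \<le> N"
  defines "y \<equiv> 2 * \<tau> / (j - 1)" and "e \<equiv> j * (j - 1) / (N - 1)" and "\<epsilon> \<equiv> sqrt N / j"
  defines "r \<equiv> y\<^sup>2 * e / j"
  shows "(y\<^sup>2 / (2 * j) * (\<epsilon> * e\<^sup>2 + 1 / \<epsilon>) + r\<^sup>2 / 2)
      + (2 * \<bar>y\<bar> ^ 3 / (3 * j) + 4 * y\<^sup>2 / j\<^sup>2 + y\<^sup>2 / (2 * j) * \<epsilon> * (1 - 2 * e)) * e
      + (4 * y\<^sup>2 / j\<^sup>2 + y\<^sup>2 / (2 * j) * \<epsilon>) * (j * (j - 1)\<^sup>2 * (j - 2) / ((N - 1) * (N - 2)))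
    \<le> (4 * \<tau>\<^sup>2 / sqrt N + 32 * \<tau> ^ 4 / N\<^sup>2 + 11 * \<bar>\<tau>\<bar> ^ 3 / N + 16 * \<tau>\<^sup>2 / N) * (1 / (j - 1)\<^sup>2) + 64 * \<tau>\<^sup>2 / N\<^sup>2"
    (is "?a + ?b * e + ?c * ?e2 \<le> _")
proof -
  define i where "i = j - 1"
  have pos: "0 < j" "0 < i" "0 < N" "0 < N - 1" "0 < N - 2" "0 < sqrt N" using j by (auto simp: i_def)
  have eps: "0 < \<epsilon>" unfolding \<epsilon>_def using pos by simp
  have e0: "0 \<le> e" unfolding e_def using pos by (simp add: i_def)
  have e_le: "e \<le> j\<^sup>2 / N"
  proof -
    have "j * (j - 1) * N \<le> j\<^sup>2 * (N - 1)"
    proof -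
      have "j\<^sup>2 * (N - 1) - j * (j - 1) * N = j * (N - j)" by (simp add: algebra_simps power2_eq_square)
      moreover have "0 \<le> j * (N - j)" using j by simp
      ultimately show ?thesis by linarith
    qed
    then show ?thesis unfolding e_def using pos by (simp add: divide_simps)
  qed
  have e2: "?e2 \<le> e\<^sup>2"
  proof -
    have "(j - 2) * (N - 1) \<le> j * (N - 2)" using j by (simp add: algebra_simps)
    then have "(j - 2) / (N - 2) \<le> j / (N - 1)" using pos by (simp add: divide_simps)
    then have "j * (j - 1)\<^sup>2 / (N - 1) * ((j - 2) / (N - 2)) \<le> j * (j - 1)\<^sup>2 / (N - 1) * (j / (N - 1))"
      using pos by (intro mult_left_mono) auto
    moreover have "?e2 = j * (j - 1)\<^sup>2 / (N - 1) * ((j - 2) / (N - 2))" by simp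
    moreover have "e\<^sup>2 = j * (j - 1)\<^sup>2 / (N - 1) * (j / (N - 1))"
      unfolding e_def by (simp add: power2_eq_square)
    ultimately show ?thesis by (simp only:)
  qed
  have c0: "0 \<le> ?c" using pos eps by simp
  have "?a + ?b * e + ?c * ?e2 \<le> ?a + ?b * e + ?c * e\<^sup>2"
    using mult_left_mono[OF e2 c0] by simp
  also have "\<dots> = y\<^sup>2 / (2 * j) * (1 / \<epsilon> + \<epsilon> * e) + r\<^sup>2 / 2 + 2 * \<bar>y\<bar> ^ 3 / (3 * j) * e + 4 * y\<^sup>2 / j\<^sup>2 * (e + e\<^sup>2)"
    by (simp add: algebra_simps power2_eq_square add_divide_distrib diff_divide_distrib)
  also have "\<dots> \<le> 4 * \<tau>\<^sup>2 / sqrt N * (1 / i\<^sup>2) + 32 * \<tau> ^ 4 / N\<^sup>2 * (1 / i\<^sup>2) + 11 * \<bar>\<tau>\<bar> ^ 3 / N * (1 / i\<^sup>2)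
      + (16 * \<tau>\<^sup>2 / N * (1 / i\<^sup>2) + 64 * \<tau>\<^sup>2 / N\<^sup>2)"
  proof (intro add_mono)
    have y2: "y\<^sup>2 = 4 * \<tau>\<^sup>2 / i\<^sup>2" unfolding y_def i_def by (simp add: power_divide power_mult_distrib)
    show "y\<^sup>2 / (2 * j) * (1 / \<epsilon> + \<epsilon> * e) \<le> 4 * \<tau>\<^sup>2 / sqrt N * (1 / i\<^sup>2)"
    proof -
      have "\<epsilon> * e \<le> \<epsilon> * (j\<^sup>2 / N)" using e_le eps by (intro mult_left_mono) auto
      also have "\<dots> = j / sqrt N"
        unfolding \<epsilon>_def using pos by (simp add: divide_simps power2_eq_square)
      finally have "1 / \<epsilon> + \<epsilon> * e \<le> 2 * j / sqrt N" unfolding \<epsilon>_def by simp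
      then have "y\<^sup>2 / (2 * j) * (1 / \<epsilon> + \<epsilon> * e) \<le> y\<^sup>2 / (2 * j) * (2 * j / sqrt N)"
        using pos by (intro mult_left_mono) auto
      also have "\<dots> = 4 * \<tau>\<^sup>2 / sqrt N * (1 / i\<^sup>2)" unfolding y2 using pos by simp
      finally show ?thesis .
    qed
    have r: "r = 4 * \<tau>\<^sup>2 / (i * (N - 1))"
      unfolding r_def y2 e_def i_def[symmetric] using pos by (simp add: power2_eq_square)
    have inv: "1 / (N - 1) \<le> 2 / N" using j by (simp add: divide_simps)
    show "r\<^sup>2 / 2 \<le> 32 * \<tau> ^ 4 / N\<^sup>2 * (1 / i\<^sup>2)"
    proof -
      have "r\<^sup>2 / 2 = 8 * \<tau> ^ 4 / i\<^sup>2 * (1 / (N - 1))\<^sup>2"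
        unfolding r by (simp add: power_divide power_mult_distrib flip: power_mult)
      also have "\<dots> \<le> 8 * \<tau> ^ 4 / i\<^sup>2 * (2 / N)\<^sup>2"
        using inv pos by (intro mult_left_mono power_mono) auto
      also have "\<dots> = 32 * \<tau> ^ 4 / N\<^sup>2 * (1 / i\<^sup>2)" by (simp add: power_divide)
      finally show ?thesis .
    qed
    show "2 * \<bar>y\<bar> ^ 3 / (3 * j) * e \<le> 11 * \<bar>\<tau>\<bar> ^ 3 / N * (1 / i\<^sup>2)"
    proof -
      have y3: "\<bar>y\<bar> ^ 3 = 8 * \<bar>\<tau>\<bar> ^ 3 / i ^ 3"
        unfolding y_def i_def[symmetric] using pos by (simp add: power_divide power_mult_distrib abs_mult)
      have "2 * \<bar>y\<bar> ^ 3 / (3 * j) * e = 16 / 3 * \<bar>\<tau>\<bar> ^ 3 / i\<^sup>2 * (1 / (N - 1))"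
        unfolding y3 e_def i_def[symmetric] using pos by (simp add: divide_simps power3_eq_cube power2_eq_square)
      also have "\<dots> \<le> 16 / 3 * \<bar>\<tau>\<bar> ^ 3 / i\<^sup>2 * (2 / N)"
        using inv pos by (intro mult_left_mono) auto
      also have "\<dots> = 32 / 3 * (\<bar>\<tau>\<bar> ^ 3 / N * (1 / i\<^sup>2))" by simp
      also have "\<dots> \<le> 11 * (\<bar>\<tau>\<bar> ^ 3 / N * (1 / i\<^sup>2))"
        using pos by (intro mult_right_mono) auto
      finally show ?thesis by simp
    qed
    show "4 * y\<^sup>2 / j\<^sup>2 * (e + e\<^sup>2) \<le> 16 * \<tau>\<^sup>2 / N * (1 / i\<^sup>2) + 64 * \<tau>\<^sup>2 / N\<^sup>2"
    proof -
      have "e + e\<^sup>2 \<le> j\<^sup>2 / N + (j\<^sup>2 / N)\<^sup>2" using e_le e0 by (intro add_mono power_mono) auto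
      then have "4 * y\<^sup>2 / j\<^sup>2 * (e + e\<^sup>2) \<le> 4 * y\<^sup>2 / j\<^sup>2 * (j\<^sup>2 / N + (j\<^sup>2 / N)\<^sup>2)"
        using pos by (intro mult_left_mono) auto
      also have "\<dots> = 16 * \<tau>\<^sup>2 / N * (1 / i\<^sup>2) + 16 * \<tau>\<^sup>2 / N\<^sup>2 * (j\<^sup>2 / i\<^sup>2)"
        unfolding y2 using pos by (simp add: field_simps power2_eq_square)
      also have "16 * \<tau>\<^sup>2 / N\<^sup>2 * (j\<^sup>2 / i\<^sup>2) \<le> 16 * \<tau>\<^sup>2 / N\<^sup>2 * 4"
      proof (rule mult_left_mono)
        have "j / i \<le> 2" using j unfolding i_def by (simp add: divide_simps)
        then have "(j / i)\<^sup>2 \<le> 2\<^sup>2" using pos by (intro power_mono) auto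
        then show "j\<^sup>2 / i\<^sup>2 \<le> 4" by (simp add: power_divide)
      qed simp
      finally show ?thesis by simp
    qed
  qed
  also have "\<dots> = (4 * \<tau>\<^sup>2 / sqrt N + 32 * \<tau> ^ 4 / N\<^sup>2 + 11 * \<bar>\<tau>\<bar> ^ 3 / N + 16 * \<tau>\<^sup>2 / N) * (1 / i\<^sup>2) + 64 * \<tau>\<^sup>2 / N\<^sup>2"
    by (simp only: distrib_right add.assoc)
  finally show ?thesis unfolding i_def .
qed

lemma char_recursion_bound:
  fixes \<phi> :: "real \<Rightarrow> complex" and \<tau> :: real and N m :: nat
  assumes phi: "\<And>u. cmod (\<phi> u) \<le> 1" "\<And>u. cmod (\<phi> u * iexp (- u) - 1) \<le> 2 * u\<^sup>2"
    and m: "3 \<le> m" "m \<le> N"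
  shows "cmod (iexp (- 2 * \<tau>) * chain_expectation (\<lambda>k v. \<phi> (\<tau> * (v / (k choose 2)))) (N - 1) N
       - exp (- (4 * \<tau>\<^sup>2 / (real N - 1) * (\<Sum>j\<in>{m<..N}. 1 / (real j - 1)))))
    \<le> 2 * (real m)\<^sup>2 / N + (4 * \<tau>\<^sup>2 / sqrt N + 32 * \<tau> ^ 4 / (real N)\<^sup>2 + 11 * \<bar>\<tau>\<bar> ^ 3 / N + 16 * \<tau>\<^sup>2 / N) * (2 / real m)
      + 64 * \<tau>\<^sup>2 / N"
proof -
  define F where "F = (\<lambda>k (v::nat). \<phi> (\<tau> * (v / (k choose 2))))"
  \<comment> \<open>\<open>2 v / j\<close> is the conditional mean of the external length still to come, given \<open>v\<close> singletons
    among \<open>j\<close> blocks.\<close>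
  define H where "H j v = iexp (- 2 * \<tau> * (real v / real j)) * chain_expectation F (j - 1) v" for j v :: nat
  define y where "y j = 2 * \<tau> / (real j - 1)" for j :: nat
  define e where "e j = real j * (real j - 1) / (real N - 1)" for j :: nat
  define \<epsilon> where "\<epsilon> j = sqrt N / real j" for j :: nat
  define r where "r j = (y j)\<^sup>2 * e j / real j" for j :: nat
  define z where "z j v = \<phi> (y j * real v / real j) * iexp (- (y j * real v / real j))" for j v :: nat
  define \<psi> where "\<psi> j v x = z j v * iexp (- y j * (real x - 2 * real v / real j))" for j v x :: nat
  define a where "a j = (y j)\<^sup>2 / (2 * real j) * (\<epsilon> j * (e j)\<^sup>2 + 1 / \<epsilon> j) + (r j)\<^sup>2 / 2" for j :: nat
  define b where "b j = 2 * \<bar>y j\<bar> ^ 3 / (3 * real j) + 4 * (y j)\<^sup>2 / (real j)\<^sup>2 + (y j)\<^sup>2 / (2 * real j) * \<epsilon> j * (1 - 2 * e j)" for j :: nat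
  define c where "c j = 4 * (y j)\<^sup>2 / (real j)\<^sup>2 + (y j)\<^sup>2 / (2 * real j) * \<epsilon> j" for j :: nat
  have F1: "cmod (F k v) \<le> 1" for k v unfolding F_def by (rule phi)
  have "\<phi> 0 = 1" using phi(2)[of 0] by simp
  then have F0: "F k 0 = 1" for k unfolding F_def by simp
  have z: "cmod (z j v) \<le> 1" "cmod (z j v - 1) \<le> 2 * (y j * real v / real j)\<^sup>2" for j v
    unfolding z_def using phi(1) phi(2)[of "y j * real v / real j"] by (simp_all add: norm_mult)
  have base: "cmod (H m v - 1) \<le> 2 * real v" if "v \<le> m" for v
  proof (cases "v = 0")
    case True
    then show ?thesis unfolding H_def using chain_expectation_zero[of F, OF F0] by simp
  next
    case False
    have "cmod (H m v) \<le> 1" unfolding H_def using cmod_chain_expectation_le_1[of F v "m - 1", OF F1] that m(1)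
      by (simp add: norm_mult)
    then have "cmod (H m v - 1) \<le> 2" using norm_triangle_ineq4[of "H m v" 1] by simp
    also have "2 \<le> 2 * real v" using False by simp
    finally show ?thesis .
  qed
  have step: "H (Suc j) v = (\<Sum>x\<le>2. hyp2 (Suc j) v x * (\<psi> (Suc j) v x * H j (v - x)))" if "m \<le> j" "v \<le> Suc j" for j v
  proof -
    have "j \<noteq> 0" using m(1) that(1) by simp
    then obtain k where k: "j = Suc k" using not0_implies_Suc by blast
    have j: "real j > 0" using k by simp
    have u: "\<tau> * (real v / real (Suc j choose 2)) = y (Suc j) * real v / real (Suc j)"
      unfolding y_def real_choose_two using j by (simp add: field_simps)
    have t: "hyp2 (Suc j) v x * (\<psi> (Suc j) v x * H j (v - x))
       = iexp (- 2 * \<tau> * (real v / real (Suc j))) * F (Suc j) v * (hyp2 (Suc j) v x * chain_expectation F k (v - x))" if x: "x \<in> {..2}" for x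
    proof (cases "hyp2 (Suc j) v x = 0")
      case False
      then have "x \<le> v" using hyp2_support(1)[OF False \<open>v \<le> Suc j\<close>] x by simp
      then have ex: "- (y (Suc j) * real v / real (Suc j)) + - y (Suc j) * (real x - 2 * real v / real (Suc j)) + - 2 * \<tau> * (real (v - x) / real j)
         = - 2 * \<tau> * (real v / real (Suc j))"
        unfolding y_def using j by (simp add: of_nat_diff divide_simps) (simp add: algebra_simps)
      have "\<psi> (Suc j) v x * H j (v - x) = F (Suc j) v * (iexp (- (y (Suc j) * real v / real (Suc j))) * iexp (- y (Suc j) * (real x - 2 * real v / real (Suc j))) * iexp (- 2 * \<tau> * (real (v - x) / real j))) * chain_expectation F k (v - x)"
        unfolding \<psi>_def z_def H_def F_def u using k by (simp only: mult.assoc mult.commute mult.left_commute diff_Suc_1)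
      also have "iexp (- (y (Suc j) * real v / real (Suc j))) * iexp (- y (Suc j) * (real x - 2 * real v / real (Suc j))) * iexp (- 2 * \<tau> * (real (v - x) / real j))
          = iexp (- 2 * \<tau> * (real v / real (Suc j)))"
        unfolding ex[symmetric] of_real_add distrib_left exp_add ..
      finally show ?thesis by (simp add: algebra_simps)
    qed simp
    have "(\<Sum>x\<le>2. hyp2 (Suc j) v x * (\<psi> (Suc j) v x * H j (v - x)))
       = (\<Sum>x\<le>2. iexp (- 2 * \<tau> * (real v / real (Suc j))) * F (Suc j) v * (hyp2 (Suc j) v x * chain_expectation F k (v - x)))"
      by (rule sum.cong[OF refl t])
    also have "\<dots> = iexp (- 2 * \<tau> * (real v / real (Suc j))) * F (Suc j) v * (\<Sum>x\<le>2. hyp2 (Suc j) v x * chain_expectation F k (v - x))"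
      by (rule sum_distrib_left[symmetric])
    also have "\<dots> = H (Suc j) v" unfolding H_def k by simp
    finally show ?thesis by simp
  qed
  have psi: "cmod (\<psi> j v x) \<le> 1" for j v x
    unfolding \<psi>_def using z(1) by (simp add: norm_mult)
  have e0: "0 \<le> e j" if "m < j" for j unfolding e_def using that m by simp
  have r0: "0 \<le> r j" if "m < j" for j unfolding r_def using e0[OF that] by simp
  have q: "\<bar>exp (- r j)\<bar> \<le> 1" if "m < j" for j using r0[OF that] by simp
  have err: "cmod ((\<Sum>x\<le>2. hyp2 j v x * \<psi> j v x) - exp (- r j)) \<le> a j + b j * real v + c j * (real v * (real v - 1))"
    if "m < j" "v \<le> j" for j v
    unfolding a_def b_def c_def \<psi>_def
    by (rule step_char_bound) (use that m e0 z r_def in \<open>auto simp: \<epsilon>_def\<close>)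
  have N: "3 \<le> real N" using m by simp
  have nz: "real N \<noteq> 0" "real N - 1 \<noteq> 0" "real N - 2 \<noteq> 0" using N by auto
  have "cmod (H N N - (\<Prod>j\<in>{m<..N}. exp (- r j))) \<le>
    (\<Sum>j\<in>{m<..N}. a j) + (2 * (real m * (real m - 1)) + (\<Sum>j\<in>{m<..N}. b j * (real j * (real j - 1)))) / (real N * (real N - 1)) * real N
      + (\<Sum>j\<in>{m<..N}. c j * (real j * (real j - 1)\<^sup>2 * (real j - 2))) / (real N * (real N - 1)\<^sup>2 * (real N - 2)) * (real N * (real N - 1))"
    by (rule recursion_bound[where \<psi> = \<psi>, OF m base step psi q err order_refl])
  also have "\<dots> = 2 * (real m * (real m - 1)) / (real N - 1) + (\<Sum>j\<in>{m<..N}. a j + b j * e j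
      + c j * (real j * (real j - 1)\<^sup>2 * (real j - 2) / ((real N - 1) * (real N - 2))))"
  proof -
    have "(2 * (real m * (real m - 1)) + (\<Sum>j\<in>{m<..N}. b j * (real j * (real j - 1)))) / (real N * (real N - 1)) * real N
       = 2 * (real m * (real m - 1)) / (real N - 1) + (\<Sum>j\<in>{m<..N}. b j * e j)"
    proof -
      have *: "S / (real N * (real N - 1)) * real N = S / (real N - 1)" for S
        using nz by simp
      show ?thesis unfolding * e_def by (simp add: add_divide_distrib sum_divide_distrib)
    qed
    moreover have "(\<Sum>j\<in>{m<..N}. c j * (real j * (real j - 1)\<^sup>2 * (real j - 2))) / (real N * (real N - 1)\<^sup>2 * (real N - 2)) * (real N * (real N - 1))
       = (\<Sum>j\<in>{m<..N}. c j * (real j * (real j - 1)\<^sup>2 * (real j - 2) / ((real N - 1) * (real N - 2))))"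
    proof -
      have *: "S / (real N * (real N - 1)\<^sup>2 * (real N - 2)) * (real N * (real N - 1)) = S / ((real N - 1) * (real N - 2))" for S
        using nz by (simp add: power2_eq_square)
      show ?thesis unfolding * by (simp add: sum_divide_distrib)
    qed
    ultimately show ?thesis by (simp add: sum.distrib)
  qed
  also have "\<dots> \<le> 2 * (real m)\<^sup>2 / N + (\<Sum>j\<in>{m<..N}.
     (4 * \<tau>\<^sup>2 / sqrt N + 32 * \<tau> ^ 4 / (real N)\<^sup>2 + 11 * \<bar>\<tau>\<bar> ^ 3 / N + 16 * \<tau>\<^sup>2 / N) * (1 / (real j - 1)\<^sup>2) + 64 * \<tau>\<^sup>2 / (real N)\<^sup>2)"
  proof (rule add_mono[OF _ sum_mono])
    have "real m * (real m - 1) * real N \<le> (real m)\<^sup>2 * (real N - 1)"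
    proof -
      have "(real m)\<^sup>2 * (real N - 1) - real m * (real m - 1) * real N = real m * (real N - real m)"
        by (simp add: algebra_simps power2_eq_square)
      moreover have "0 \<le> real m * (real N - real m)" using m by simp
      ultimately show ?thesis by linarith
    qed
    then show "2 * (real m * (real m - 1)) / (real N - 1) \<le> 2 * (real m)\<^sup>2 / N"
      using N by (simp add: divide_simps)
  next
    fix j assume j: "j \<in> {m<..N}"
    then have "3 < real j" "real j \<le> real N" using m by auto
    from step_error_total[OF this, of \<tau>]
    show "a j + b j * e j + c j * (real j * (real j - 1)\<^sup>2 * (real j - 2) / ((real N - 1) * (real N - 2)))
      \<le> (4 * \<tau>\<^sup>2 / sqrt N + 32 * \<tau> ^ 4 / (real N)\<^sup>2 + 11 * \<bar>\<tau>\<bar> ^ 3 / N + 16 * \<tau>\<^sup>2 / N) * (1 / (real j - 1)\<^sup>2) + 64 * \<tau>\<^sup>2 / (real N)\<^sup>2"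
      unfolding a_def b_def c_def r_def e_def \<epsilon>_def y_def by simp
  qed
  also have "\<dots> = 2 * (real m)\<^sup>2 / N + ((4 * \<tau>\<^sup>2 / sqrt N + 32 * \<tau> ^ 4 / (real N)\<^sup>2 + 11 * \<bar>\<tau>\<bar> ^ 3 / N + 16 * \<tau>\<^sup>2 / N)
      * (\<Sum>j\<in>{m<..N}. 1 / (real j - 1)\<^sup>2) + real (N - m) * (64 * \<tau>\<^sup>2 / (real N)\<^sup>2))"
    by (simp only: sum.distrib sum_distrib_left) simp
  also have "\<dots> \<le> 2 * (real m)\<^sup>2 / N + ((4 * \<tau>\<^sup>2 / sqrt N + 32 * \<tau> ^ 4 / (real N)\<^sup>2 + 11 * \<bar>\<tau>\<bar> ^ 3 / N + 16 * \<tau>\<^sup>2 / N)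
      * (2 / real m) + 64 * \<tau>\<^sup>2 / N)"
  proof (intro add_mono order_refl mult_left_mono sum_inverse_squares_le)
    have "real (N - m) * (64 * \<tau>\<^sup>2 / (real N)\<^sup>2) \<le> real N * (64 * \<tau>\<^sup>2 / (real N)\<^sup>2)"
      by (intro mult_right_mono) auto
    also have "\<dots> = 64 * \<tau>\<^sup>2 / N" using nz by (simp add: power2_eq_square)
    finally show "real (N - m) * (64 * \<tau>\<^sup>2 / (real N)\<^sup>2) \<le> 64 * \<tau>\<^sup>2 / N" .
  qed (use m in auto)
  finally have main: "cmod (H N N - (\<Prod>j\<in>{m<..N}. exp (- r j))) \<le> 2 * (real m)\<^sup>2 / N
      + ((4 * \<tau>\<^sup>2 / sqrt N + 32 * \<tau> ^ 4 / (real N)\<^sup>2 + 11 * \<bar>\<tau>\<bar> ^ 3 / N + 16 * \<tau>\<^sup>2 / N) * (2 / real m) + 64 * \<tau>\<^sup>2 / N)" .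
  have "(\<Prod>j\<in>{m<..N}. exp (- r j)) = exp (- (4 * \<tau>\<^sup>2 / (real N - 1) * (\<Sum>j\<in>{m<..N}. 1 / (real j - 1))))"
  proof -
    have "r j = 4 * \<tau>\<^sup>2 / (real N - 1) * (1 / (real j - 1))" if "j \<in> {m<..N}" for j
    proof -
      have "real j \<noteq> 0" "real j - 1 \<noteq> 0" using that m by auto
      then show ?thesis unfolding r_def e_def y_def by (simp add: power_divide power_mult_distrib) (simp add: power2_eq_square)
    qed
    then have "(\<Sum>j\<in>{m<..N}. r j) = 4 * \<tau>\<^sup>2 / (real N - 1) * (\<Sum>j\<in>{m<..N}. 1 / (real j - 1))"
      unfolding sum_distrib_left by (rule sum.cong[OF refl])
    then show ?thesis by (simp add: exp_sum[symmetric] sum_negf)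
  qed
  moreover have "H N N = iexp (- 2 * \<tau>) * chain_expectation (\<lambda>k v. \<phi> (\<tau> * (v / (k choose 2)))) (N - 1) N"
    unfolding H_def F_def using nz by simp
  ultimately show ?thesis using main by (simp only: add.assoc)
qed

subsection \<open>Asymptotics\<close>

definition normalizer :: "nat \<Rightarrow> real" where
  "normalizer n = 1 / 2 * sqrt (real n / ln (real n))"

text \<open>The cutoff has to be small compared to \<open>sqrt n\<close>, so that no singletons are left among that
  many blocks, and large compared to \<open>sqrt (n / ln n)\<close>, so that the normalized increments above
  the cutoff are uniformly small.\<close>
definition cutoff :: "nat \<Rightarrow> real" where
  "cutoff n = sqrt (real n) / ln (real n) powr (1 / 4)"

lemma error_term_tendsto_0:
  fixes s :: real
  shows "(\<lambda>n. 2 * (cutoff n + 1)\<^sup>2 / n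
     + (4 * (s * normalizer n)\<^sup>2 / sqrt n + 32 * (s * normalizer n) ^ 4 / (real n)\<^sup>2 + 11 * (s * normalizer n) ^ 3 / n + 16 * (s * normalizer n)\<^sup>2 / n) * (2 / cutoff n)
     + 64 * (s * normalizer n)\<^sup>2 / n) \<longlonglongrightarrow> 0"
proof -
  have 1: "(\<lambda>n. 2 * (cutoff n + 1)\<^sup>2 / n) \<longlonglongrightarrow> 0" unfolding cutoff_def by real_asymp
  have 2: "(\<lambda>n. 4 * (normalizer n)\<^sup>2 / sqrt n * (2 / cutoff n)) \<longlonglongrightarrow> 0" unfolding cutoff_def normalizer_def by real_asymp
  have 3: "(\<lambda>n. 32 * (normalizer n) ^ 4 / (real n)\<^sup>2 * (2 / cutoff n)) \<longlonglongrightarrow> 0" unfolding cutoff_def normalizer_def by real_asymp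
  have 4: "(\<lambda>n. 11 * (normalizer n) ^ 3 / n * (2 / cutoff n)) \<longlonglongrightarrow> 0" unfolding cutoff_def normalizer_def by real_asymp
  have 5: "(\<lambda>n. 16 * (normalizer n)\<^sup>2 / n * (2 / cutoff n)) \<longlonglongrightarrow> 0" unfolding cutoff_def normalizer_def by real_asymp
  have 6: "(\<lambda>n. 64 * (normalizer n)\<^sup>2 / n) \<longlonglongrightarrow> 0" unfolding normalizer_def by real_asymp
  have "(\<lambda>n. 2 * (cutoff n + 1)\<^sup>2 / n + (s\<^sup>2 * (4 * (normalizer n)\<^sup>2 / sqrt n * (2 / cutoff n))
      + s ^ 4 * (32 * (normalizer n) ^ 4 / (real n)\<^sup>2 * (2 / cutoff n)) + s ^ 3 * (11 * (normalizer n) ^ 3 / n * (2 / cutoff n))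
      + s\<^sup>2 * (16 * (normalizer n)\<^sup>2 / n * (2 / cutoff n))) + s\<^sup>2 * (64 * (normalizer n)\<^sup>2 / n))
     \<longlonglongrightarrow> 0 + (s\<^sup>2 * 0 + s ^ 4 * 0 + s ^ 3 * 0 + s\<^sup>2 * 0) + s\<^sup>2 * 0"
    by (intro tendsto_add tendsto_mult tendsto_const 1 2 3 4 5 6)
  then show ?thesis by (simp add: power_mult_distrib algebra_simps)
qed

lemma exponent_bounds_tendsto:
  "(\<lambda>n. 4 * (normalizer n)\<^sup>2 / (real n - 1) * (ln (real n) - ln (cutoff n + 1))) \<longlonglongrightarrow> 1 / 2"
  "(\<lambda>n. 4 * (normalizer n)\<^sup>2 / (real n - 1) * (ln (real n) - ln (cutoff n) + 1 / cutoff n)) \<longlonglongrightarrow> 1 / 2"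
  unfolding normalizer_def cutoff_def 
  by (real_asymp, simp add: power2_eq_square, real_asymp, simp add: power2_eq_square)

theorem theorem1:
  shows "weak_conv_m
           (\<lambda>n. distr (kingman n) borel
                  (\<lambda>\<omega>. (1/2) * sqrt (real n / ln (real n)) * (ext_length n \<omega> - 2)))
           std_normal_distribution"
proof (rule levy_continuity)
  fix n
  interpret K: prob_space "kingman n" by (rule prob_space_kingman)
  show "real_distribution (distr (kingman n) borel (\<lambda>\<omega>. (1/2) * sqrt (real n / ln (real n)) * (ext_length n \<omega> - 2)))"
    by (rule K.real_distribution_distr) measurable
next
  show "real_distribution std_normal_distribution"
    by (rule real_dist_normal_dist)
next
  fix t :: real
  interpret E: real_distribution exp1 by (rule real_distribution_exp1)
  let ?c = "\<lambda>n. char (distr (kingman n) borel (\<lambda>\<omega>. (1/2) * sqrt (real n / ln (real n)) * (ext_length n \<omega> - 2))) t"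
  define m where "m n = nat \<lceil>cutoff n\<rceil>" for n
  define h where "h n = (\<Sum>j\<in>{m n<..n}. 1 / (real j - 1))" for n
  define A where "A n = 4 * (t * normalizer n)\<^sup>2 / (real n - 1) * h n" for n
  have "eventually (\<lambda>n. 3 \<le> cutoff n) sequentially" "eventually (\<lambda>n. cutoff n \<le> real n) sequentially"
    unfolding cutoff_def by real_asymp+
  then have "eventually (\<lambda>n::nat. 3 \<le> cutoff n \<and> cutoff n \<le> real n \<and> 3 \<le> n) sequentially"
    by (intro eventually_conj eventually_ge_at_top)
  then have ev: "eventually (\<lambda>n. 3 \<le> n \<and> 3 \<le> cutoff n \<and> 3 \<le> m n \<and> m n \<le> n \<and> cutoff n \<le> real (m n) \<and> real (m n) \<le> cutoff n + 1) sequentially"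
  proof eventually_elim
    case (elim n)
    then show ?case unfolding m_def by (auto simp: le_nat_iff nat_le_iff ceiling_le_iff)
  qed
  have "eventually (\<lambda>n. cmod (?c n - exp (- A n)) \<le> 2 * (cutoff n + 1)\<^sup>2 / n
     + (4 * (\<bar>t\<bar> * normalizer n)\<^sup>2 / sqrt n + 32 * (\<bar>t\<bar> * normalizer n) ^ 4 / (real n)\<^sup>2 + 11 * (\<bar>t\<bar> * normalizer n) ^ 3 / n
        + 16 * (\<bar>t\<bar> * normalizer n)\<^sup>2 / n) * (2 / cutoff n)
     + 64 * (\<bar>t\<bar> * normalizer n)\<^sup>2 / n) sequentially"
    using ev
  proof eventually_elim
    case (elim n)
    have sc: "0 \<le> normalizer n" unfolding normalizer_def using elim by simp
    have eq: "?c n = iexp (- 2 * (t * normalizer n)) * chain_expectation (\<lambda>k v. char exp1 (t * normalizer n * (v / (k choose 2)))) (n - 1) n"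
      using char_kingman[of n "normalizer n" t] elim unfolding normalizer_def by simp
    have "cmod (?c n - exp (- A n)) \<le> 2 * (real (m n))\<^sup>2 / n
       + (4 * (t * normalizer n)\<^sup>2 / sqrt n + 32 * (t * normalizer n) ^ 4 / (real n)\<^sup>2 + 11 * \<bar>t * normalizer n\<bar> ^ 3 / n + 16 * (t * normalizer n)\<^sup>2 / n) * (2 / real (m n))
       + 64 * (t * normalizer n)\<^sup>2 / n"
      unfolding eq A_def h_def
      by (rule char_recursion_bound) (use elim E.cmod_char_le_1 char_exp1_bound in auto)
    also have "\<dots> \<le> 2 * (cutoff n + 1)\<^sup>2 / n
       + (4 * (t * normalizer n)\<^sup>2 / sqrt n + 32 * (t * normalizer n) ^ 4 / (real n)\<^sup>2 + 11 * \<bar>t * normalizer n\<bar> ^ 3 / n + 16 * (t * normalizer n)\<^sup>2 / n) * (2 / cutoff n)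
       + 64 * (t * normalizer n)\<^sup>2 / n"
      using elim
      by (intro add_mono mult_left_mono divide_right_mono power_mono divide_left_mono order_refl) auto
    finally show ?case using sc by (simp add: abs_mult power_mult_distrib)
  qed
  then have "(\<lambda>n. ?c n - exp (- A n)) \<longlonglongrightarrow> 0"
    by (rule Lim_null_comparison) (rule error_term_tendsto_0)
  moreover have "A \<longlonglongrightarrow> t\<^sup>2 * (1 / 2)"
  proof (rule tendsto_sandwich)
    show "(\<lambda>n. t\<^sup>2 * (4 * (normalizer n)\<^sup>2 / (real n - 1) * (ln (real n) - ln (cutoff n + 1)))) \<longlonglongrightarrow> t\<^sup>2 * (1 / 2)"
      "(\<lambda>n. t\<^sup>2 * (4 * (normalizer n)\<^sup>2 / (real n - 1) * (ln (real n) - ln (cutoff n) + 1 / cutoff n))) \<longlonglongrightarrow> t\<^sup>2 * (1 / 2)"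
      by (intro tendsto_mult tendsto_const exponent_bounds_tendsto)+
    have AA: "A n = t\<^sup>2 * (4 * (normalizer n)\<^sup>2 / (real n - 1) * h n)" for n
      unfolding A_def by (simp add: power_mult_distrib)
    show "eventually (\<lambda>n. t\<^sup>2 * (4 * (normalizer n)\<^sup>2 / (real n - 1) * (ln (real n) - ln (cutoff n + 1))) \<le> A n) sequentially"
      using ev
    proof eventually_elim
      case (elim n)
      have "ln (real (m n)) \<le> ln (cutoff n + 1)" using elim by simp
      then have "ln (real n) - ln (cutoff n + 1) \<le> h n"
        using harmonic_block_bounds(1)[of "m n" n, folded h_def] elim by linarith
      then show ?case unfolding AA using elim by (intro mult_left_mono) auto
    qed
    show "eventually (\<lambda>n. A n \<le> t\<^sup>2 * (4 * (normalizer n)\<^sup>2 / (real n - 1) * (ln (real n) - ln (cutoff n) + 1 / cutoff n))) sequentially"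
      using ev
    proof eventually_elim
      case (elim n)
      have "ln (cutoff n) \<le> ln (real (m n))" "1 / real (m n) \<le> 1 / cutoff n"
        using elim by (auto intro: divide_left_mono)
      then have "h n \<le> ln (real n) - ln (cutoff n) + 1 / cutoff n"
        using harmonic_block_bounds(2)[of "m n" n, folded h_def] elim by linarith
      then show ?case unfolding AA using elim by (intro mult_left_mono) auto
    qed
  qed
  then have "(\<lambda>n. complex_of_real (exp (- A n))) \<longlonglongrightarrow> complex_of_real (exp (- (t\<^sup>2 * (1 / 2))))"
    by (intro tendsto_intros)
  ultimately have "(\<lambda>n. (?c n - exp (- A n)) + exp (- A n)) \<longlonglongrightarrow> 0 + complex_of_real (exp (- (t\<^sup>2 * (1 / 2))))"
    by (rule tendsto_add)
  then show "?c \<longlonglongrightarrow> char std_normal_distribution t"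
    by (simp add: char_std_normal_distribution)
qed

end
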